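(* Let $G$ be a compact Hausdorff group. A closed subspace $A\subseteq C(G)$ is an invariant algebra if and only if it is a sub-bialgebra of $C(G)$. In this case the annihilator $A^\bot\subseteq M(G)$ is a (two-sided) ideal of the convolution algebra $M(G)$, and the algebra $A'$ with the multiplication $$(\mu*\nu)(f)=(\mu\otimes\nu)(\iota(f)),\qquad \mu,\nu\in A',\ f\in A,$$ is isomorphic to $M(G)/A^\bot$.
   Context: $C(G)$ is the Banach algebra of continuous complex functions on $G$ with the sup-norm. An invariant algebra on $G$ is a closed subalgebra of $C(G)$ that contains the constants and is invariant under all left translations $L_gf(h)=f(gh)$ and right translations $R_gf(h)=f(hg)$. The comultiplication $\iota:C(G)\to C(G\times G)$ is $\iota(f)(g,h)=f(gh)$. For a subspace $L\subseteq C(G)$, $L\mathbin{\widehat\otimes}L$ is the closure in $C(G\times G)$ of the algebraic tensor product $L\otimes L$, which is identified with the linear span of the functions $(g,h)\mapsto u(g)v(h)$, $u,v\in L$. A closed subspace $A\subseteq C(G)$ is a sub-bialgebra if $\mathbf{1}\in A$, $A\cdot A\subseteq A$ (where $A\cdot A$ is the linear span of pointwise products), and $\iota(A)\subseteq A\mathbin{\widehat\otimes}A$. $M(G)=C(G)'$ is the space of finite regular complex Borel measures on $G$ with convolution $\int f\,d(\mu*\nu)=\int_{G\times G}f(gh)\,d\mu(g)\,d\nu(h)$; $A'$ is the Banach dual of $A$, and $A^\bot=\{\mu\in M(G):\int f\,d\mu=0\ \forall f\in A\}$. For $\mu,\nu\in A'$, $\mu\otimes\nu$ denotes the continuous functional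 on $A\mathbin{\widehat\otimes}A$ determined by $u\otimes v\mapsto\mu(u)\nu(v)$. *)

theory Defs
  imports "HOL-Analysis.Analysis" "HOL-Algebra.QuotRing" "HOL-Algebra.Module"
begin

text \<open>
  A topological group is a type of class \<^class>\<open>topological_group_add\<close>. Despite the additive
  notation this class does not assume commutativity: \<open>g + h\<close> is the product of \<open>g\<close> and \<open>h\<close> in
  this order, and \<open>0\<close> is the neutral element. Over a compact space every continuous function is
  bounded, so for a compact group \<open>G\<close> the type \<open>G \<Rightarrow>\<^sub>C complex\<close> with its sup-norm is \<open>C(G)\<close>.
\<close>

section \<open>Continuous complex functions\<close>

lemma bounded_range_mult:
  fixes f :: "'x \<Rightarrow> complex" and g :: "'y \<Rightarrow> complex"
  assumes "bounded (range f)" "bounded (range g)"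
  shows "bounded (range (\<lambda>p. f (a p) * g (b p)))"
proof -
  obtain F G where "\<And>x. norm (f x) \<le> F" "\<And>y. norm (g y) \<le> G"
    using assms by (auto simp: bounded_iff)
  then have "norm (f (a p) * g (b p)) \<le> F * G" for p
    by (metis norm_mult mult_mono' norm_ge_zero)
  then show ?thesis by (auto simp: bounded_iff)
qed

lemma bcontfun_comp:
  fixes f :: "'y::topological_space \<Rightarrow> complex" and a :: "'x::topological_space \<Rightarrow> 'y"
  assumes "f \<in> bcontfun" "continuous_on UNIV a"
  shows "(\<lambda>x. f (a x)) \<in> bcontfun"
  using assms continuous_on_compose2[of UNIV f UNIV a]
  by (auto simp: bcontfun_def intro: bounded_subset)

lemma bcontfun_mult:
  fixes f g :: "'x::topological_space \<Rightarrow> complex"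
  assumes "f \<in> bcontfun" "g \<in> bcontfun"
  shows "(\<lambda>x. f x * g x) \<in> bcontfun"
  using assms bounded_range_mult[of f g "\<lambda>x. x" "\<lambda>x. x"]
  by (auto simp: bcontfun_def intro!: continuous_intros)

context
  includes bcontfun.lifting
begin

lift_definition times_bcontfun ::
    "('x::topological_space \<Rightarrow>\<^sub>C complex) \<Rightarrow> ('x \<Rightarrow>\<^sub>C complex) \<Rightarrow> ('x \<Rightarrow>\<^sub>C complex)"
  is "\<lambda>f g x. f x * g x"
  by (rule bcontfun_mult)

lift_definition scaleC_bcontfun ::
    "complex \<Rightarrow> ('x::topological_space \<Rightarrow>\<^sub>C complex) \<Rightarrow> ('x \<Rightarrow>\<^sub>C complex)"
  is "\<lambda>c f x. c * f x"
  by (rule bcontfun_mult[OF const_bcontfun])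

lift_definition left_translate ::
    "'g::topological_group_add \<Rightarrow> ('g \<Rightarrow>\<^sub>C complex) \<Rightarrow> ('g \<Rightarrow>\<^sub>C complex)"
  is "\<lambda>g f h. f (g + h)"
  by (rule bcontfun_comp) (simp_all add: continuous_intros)

lift_definition right_translate ::
    "'g::topological_group_add \<Rightarrow> ('g \<Rightarrow>\<^sub>C complex) \<Rightarrow> ('g \<Rightarrow>\<^sub>C complex)"
  is "\<lambda>g f h. f (h + g)"
  by (rule bcontfun_comp) (simp_all add: continuous_intros)

lift_definition tensor_fun ::
    "('x::topological_space \<Rightarrow>\<^sub>C complex) \<Rightarrow> ('y::topological_space \<Rightarrow>\<^sub>C complex)
      \<Rightarrow> (('x \<times> 'y) \<Rightarrow>\<^sub>C complex)"
  is "\<lambda>u v p. u (fst p) * v (snd p)"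
  by (rule bcontfun_mult[OF bcontfun_comp bcontfun_comp])
    (simp_all add: continuous_on_fst continuous_on_snd continuous_on_id)

lift_definition comult ::
    "('g::topological_group_add \<Rightarrow>\<^sub>C complex) \<Rightarrow> (('g \<times> 'g) \<Rightarrow>\<^sub>C complex)"
  is "\<lambda>f p. f (fst p + snd p)"
  by (rule bcontfun_comp) (simp_all add: continuous_intros)

end

lemmas [simp] =
  times_bcontfun.rep_eq scaleC_bcontfun.rep_eq
  left_translate.rep_eq right_translate.rep_eq tensor_fun.rep_eq comult.rep_eq

text \<open>
  This makes \<open>cfun.subspace\<close> and \<open>cfun.span\<close> the complex subspaces and the complex linear span.
\<close>

interpretation cfun: vector_space "scaleC_bcontfun ::
    complex \<Rightarrow> ('x::topological_space \<Rightarrow>\<^sub>C complex) \<Rightarrow> ('x \<Rightarrow>\<^sub>C complex)"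
  by standard (auto intro!: bcontfun_eqI simp: algebra_simps)

section \<open>Invariant algebras and sub-bialgebras\<close>

definition invariant_algebra :: "('g::topological_group_add \<Rightarrow>\<^sub>C complex) set \<Rightarrow> bool" where
  "invariant_algebra A \<longleftrightarrow>
     closed A \<and> cfun.subspace A \<and>
     (\<forall>f\<in>A. \<forall>g\<in>A. times_bcontfun f g \<in> A) \<and>
     (\<forall>c. const_bcontfun c \<in> A) \<and>
     (\<forall>g. \<forall>f\<in>A. left_translate g f \<in> A) \<and>
     (\<forall>g. \<forall>f\<in>A. right_translate g f \<in> A)"

definition tensor_hat ::
    "('x::topological_space \<Rightarrow>\<^sub>C complex) set \<Rightarrow> (('x \<times> 'x) \<Rightarrow>\<^sub>C complex) set" where
  "tensor_hat L = closure (cfun.span {tensor_fun u v | u v. u \<in> L \<and> v \<in> L})"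

definition sub_bialgebra :: "('g::topological_group_add \<Rightarrow>\<^sub>C complex) set \<Rightarrow> bool" where
  "sub_bialgebra A \<longleftrightarrow>
     closed A \<and> cfun.subspace A \<and>
     const_bcontfun 1 \<in> A \<and>
     cfun.span {times_bcontfun f g | f g. f \<in> A \<and> g \<in> A} \<subseteq> A \<and>
     comult ` A \<subseteq> tensor_hat A"

section \<open>Dual spaces\<close>

text \<open>
  The Banach dual of a complex subspace \<open>A\<close>. A functional on \<open>A\<close> is a function that is
  \<^const>\<open>undefined\<close> outside \<open>A\<close>, so that equality of functionals is equality of their values on \<open>A\<close>.
\<close>

definition dual_space ::
    "('x::topological_space \<Rightarrow>\<^sub>C complex) set \<Rightarrow> (('x \<Rightarrow>\<^sub>C complex) \<Rightarrow> complex) set" where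
  "dual_space A = {\<phi> \<in> extensional A.
     (\<forall>f\<in>A. \<forall>g\<in>A. \<phi> (f + g) = \<phi> f + \<phi> g) \<and>
     (\<forall>c. \<forall>f\<in>A. \<phi> (scaleC_bcontfun c f) = c * \<phi> f) \<and>
     (\<exists>K. \<forall>f\<in>A. cmod (\<phi> f) \<le> K * norm f)}"

definition dual_norm ::
    "('x::topological_space \<Rightarrow>\<^sub>C complex) set \<Rightarrow> (('x \<Rightarrow>\<^sub>C complex) \<Rightarrow> complex) \<Rightarrow> real" where
  "dual_norm A \<phi> = (SUP f\<in>{f \<in> A. norm f \<le> 1}. cmod (\<phi> f))"

definition tensor_functional ::
    "('x::topological_space \<Rightarrow>\<^sub>C complex) set \<Rightarrow> (('x \<Rightarrow>\<^sub>C complex) \<Rightarrow> complex)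
      \<Rightarrow> (('x \<Rightarrow>\<^sub>C complex) \<Rightarrow> complex) \<Rightarrow> ((('x \<times> 'x) \<Rightarrow>\<^sub>C complex) \<Rightarrow> complex)" where
  "tensor_functional A \<mu> \<nu> = (THE \<phi>. \<phi> \<in> dual_space (tensor_hat A) \<and>
     (\<forall>u\<in>A. \<forall>v\<in>A. \<phi> (tensor_fun u v) = \<mu> u * \<nu> v))"

section \<open>The algebras \<open>M(G)\<close>, \<open>A'\<close> and \<open>M(G) / A\<^sup>\<bottom>\<close>\<close>

text \<open>
  \<open>M(G)\<close> is the dual of \<open>C(G)\<close>: by the Riesz theorem a finite regular complex Borel measure \<open>\<mu>\<close> is
  the same as the functional \<open>f \<mapsto> \<integral> f d\<mu>\<close>, and \<open>\<integral> f d\<mu>\<close> is written \<open>\<mu> f\<close>. In the convolution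
  \<open>right_translate h f\<close> is the function \<open>g \<mapsto> f(gh)\<close>, so that it is the iterated integral of
  \<open>f(gh)\<close>, first in \<open>g\<close> with respect to \<open>\<mu>\<close> and then in \<open>h\<close> with respect to \<open>\<nu>\<close>; the intermediate
  function of \<open>h\<close> is continuous. The unit is the Dirac measure at the neutral element.
\<close>

definition convolution ::
    "(('g::topological_group_add \<Rightarrow>\<^sub>C complex) \<Rightarrow> complex) \<Rightarrow> (('g \<Rightarrow>\<^sub>C complex) \<Rightarrow> complex)
      \<Rightarrow> (('g \<Rightarrow>\<^sub>C complex) \<Rightarrow> complex)" where
  "convolution \<mu> \<nu> = (\<lambda>f. \<nu> (Bcontfun (\<lambda>h. \<mu> (right_translate h f))))"

definition measure_algebra ::
    "(complex, ('g::topological_group_add \<Rightarrow>\<^sub>C complex) \<Rightarrow> complex) module" where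
  "measure_algebra =
    \<lparr>carrier = dual_space UNIV,
     mult = convolution,
     one = (\<lambda>f. apply_bcontfun f 0),
     zero = (\<lambda>f. 0),
     add = (\<lambda>\<mu> \<nu> f. \<mu> f + \<nu> f),
     smult = (\<lambda>c \<mu> f. c * \<mu> f)\<rparr>"

definition annihilator ::
    "('g::topological_group_add \<Rightarrow>\<^sub>C complex) set \<Rightarrow> (('g \<Rightarrow>\<^sub>C complex) \<Rightarrow> complex) set" where
  "annihilator A = {\<mu> \<in> dual_space UNIV. \<forall>f\<in>A. \<mu> f = 0}"

definition dual_algebra ::
    "('g::topological_group_add \<Rightarrow>\<^sub>C complex) set
      \<Rightarrow> (complex, ('g \<Rightarrow>\<^sub>C complex) \<Rightarrow> complex) module" where
  "dual_algebra A =
    \<lparr>carrier = dual_space A,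
     mult = (\<lambda>\<mu> \<nu>. \<lambda>f\<in>A. tensor_functional A \<mu> \<nu> (comult f)),
     one = (\<lambda>f\<in>A. apply_bcontfun f 0),
     zero = (\<lambda>f\<in>A. 0),
     add = (\<lambda>\<mu> \<nu>. \<lambda>f\<in>A. \<mu> f + \<nu> f),
     smult = (\<lambda>c \<mu>. \<lambda>f\<in>A. c * \<mu> f)\<rparr>"

text \<open>
  The ring \<open>R Quot I\<close> with the scalar multiplication \<open>c (x + I) = c x + I\<close>, written on cosets in
  the same way as \<^const>\<open>rcoset_mult\<close>.
\<close>

definition quotient_algebra :: "(complex, 'a) module \<Rightarrow> 'a set \<Rightarrow> (complex, 'a set) module" where
  "quotient_algebra R I = ring.extend (R Quot I)
    \<lparr>smult = (\<lambda>c X. \<Union>x\<in>X. I +>\<^bsub>R\<^esub> (c \<odot>\<^bsub>R\<^esub> x))\<rparr>"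

definition quotient_norm :: "('a \<Rightarrow> real) \<Rightarrow> 'a set \<Rightarrow> real" where
  "quotient_norm N X = (INF x\<in>X. N x)"

text \<open>Isomorphisms of Banach algebras: algebra isomorphisms that are bounded in both directions.\<close>

definition banach_algebra_iso ::
    "(complex, 'a) module \<Rightarrow> ('a \<Rightarrow> real) \<Rightarrow> (complex, 'b) module \<Rightarrow> ('b \<Rightarrow> real)
      \<Rightarrow> ('a \<Rightarrow> 'b) set" where
  "banach_algebra_iso R N S N' = {\<Phi> \<in> ring_iso R S.
     (\<forall>c. \<forall>x\<in>carrier R. \<Phi> (c \<odot>\<^bsub>R\<^esub> x) = c \<odot>\<^bsub>S\<^esub> \<Phi> x) \<and>
     (\<exists>K. \<forall>x\<in>carrier R. N' (\<Phi> x) \<le> K * N x) \<and>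
     (\<exists>K. \<forall>x\<in>carrier R. N x \<le> K * N' (\<Phi> x))}"

end

theory Submission
  imports Defs
begin

text \<open>
  If \<open>comult f\<close> lies in \<open>tensor_hat A\<close>, its slices, which are the translates of \<open>f\<close>, lie in \<open>A\<close>.
  Conversely let \<open>A\<close> be closed and translation invariant. A partition of unity shows that
  integrating \<open>comult f\<close> over one variable against any functional on \<open>C(G)\<close> yields an element of
  \<open>A\<close>. To place both legs of \<open>comult f\<close> in \<open>A\<close> one approximates the identity on the compact set of
  right translates of \<open>f\<close> by finite-rank operators on \<open>A\<close>: convolve with an approximate identity,
  which is bounded from \<open>L\<^sup>2\<close> to the sup-norm, after an orthogonal projection onto a
  finite-dimensional subspace of \<open>A\<close>. The Haar integral is obtained by von Neumann's averaging
  argument. Finally, restriction \<open>M(G) \<rightarrow> A'\<close> is multiplicative with kernel the annihilator of \<open>A\<close>,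
  and by the Hahn-Banach theorem it is onto and induces an isometry on the quotient.
\<close>

text \<open>The obstacle: slices in \<open>A\<close> do not by themselves put a function of two
  variables into \<open>tensor_hat A\<close>. A partition of unity approximates
  \<open>comult f\<close> by a sum of products of weights \<open>p i\<close> with translates of
  \<open>f\<close>, but the weights are arbitrary continuous functions, so only one leg lies in
  \<open>A\<close>. Hence the finite-rank operators with range in \<open>A\<close>. The sup-norm of
  a projection may grow with its rank, whereas in the L2 seminorm an orthogonal projection is a
  contraction whatever its rank. This dictates the order of choices: the approximate identity fixes
  the L2-to-sup constant \<open>C\<close>, the constant fixes the mesh of the net of translates, and
  only then does the rank become known. Measures never appear: elements of M(G), the Haar integral
  and product measures are all functionals, and a product is an iterated integral in one fixed
  order.\<close>

lemma compact_UNIV_bcontfunI: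
  fixes f :: "'x::topological_space \<Rightarrow> 'b::metric_space"
  assumes "compact (UNIV :: 'x set)" "continuous_on UNIV f"
  shows "f \<in> bcontfun"
  using assms compact_continuous_image[of UNIV f] compact_imp_bounded
  by (auto simp: bcontfun_def)

lemma apply_bcontfun_sum [simp]:
  fixes f :: "'i \<Rightarrow> ('x::topological_space \<Rightarrow>\<^sub>C complex)"
  shows "apply_bcontfun (\<Sum>i\<in>I. f i) x = (\<Sum>i\<in>I. apply_bcontfun (f i) x)"
  by (induction I rule: infinite_finite_induct) auto

lemma norm_scaleC_bcontfun [simp]:
  fixes f :: "'x::topological_space \<Rightarrow>\<^sub>C complex"
  shows "norm (scaleC_bcontfun c f) = cmod c * norm f"
proof (cases "c = 0")
  case True
  then show ?thesis by simp
next
  case False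
  have le: "norm (scaleC_bcontfun d g) \<le> cmod d * norm g" for d and g :: "'x \<Rightarrow>\<^sub>C complex"
    by (intro norm_bound) (simp add: norm_mult mult_left_mono norm_bounded)
  have "norm f \<le> cmod (inverse c) * norm (scaleC_bcontfun c f)"
    using le[of "inverse c" "scaleC_bcontfun c f"] False by simp
  then have "cmod c * norm f \<le> norm (scaleC_bcontfun c f)"
    using False by (simp add: norm_inverse norm_divide field_simps)
  with le[of c f] show ?thesis by simp
qed

lemma scaleC_of_real: "scaleC_bcontfun (of_real r) f = r *\<^sub>R f"
  by (rule bcontfun_eqI) (simp add: scaleR_conv_of_real)

text \<open>Total boundedness of the compact range of \<open>\<Psi>\<close>, with the net indexed by
  points of the domain, which itself carries no metric. It serves slices of a function and right
  translates of \<open>f\<close>.\<close>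

lemma finite_net_of_compact:
  fixes \<Psi> :: "'x::topological_space \<Rightarrow> 'b::metric_space"
  assumes "compact (UNIV :: 'x set)" "continuous_on UNIV \<Psi>" "e > 0"
  obtains I where "finite I" "\<And>x. \<exists>i\<in>I. dist (\<Psi> x) (\<Psi> i) < e"
proof -
  define V where "V i = {x. dist (\<Psi> x) (\<Psi> i) < e}" for i
  have "open (V i)" for i
    unfolding V_def by (intro open_Collect_less continuous_intros assms)
  moreover have "x \<in> V x" for x using \<open>e > 0\<close> by (simp add: V_def)
  then have "UNIV \<subseteq> (\<Union>i. V i)" by auto
  ultimately obtain I where I: "finite I" "UNIV \<subseteq> (\<Union>i\<in>I. V i)"
    using compactE_image[OF assms(1), of UNIV V] by (metis UNIV_I subset_UNIV)
  show thesis by (rule that[OF I(1)]) (use I(2) in \<open>auto simp: V_def\<close>)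
qed

lemma closed_mem_of_approx:
  assumes "closed A" "\<And>e. e > 0 \<Longrightarrow> \<exists>g\<in>A. norm (g - f) \<le> e"
  shows "f \<in> A"
  unfolding closed_approachable[OF assms(1), symmetric]
proof (intro allI impI)
  fix e :: real assume "e > 0"
  then obtain g where "g \<in> A" "norm (g - f) \<le> e / 2"
    using assms(2)[of "e / 2"] by auto
  then show "\<exists>y\<in>A. dist y f < e"
    using \<open>e > 0\<close> by (auto simp: dist_norm intro!: bexI[of _ g])
qed

section \<open>Functionals on \<open>C(G)\<close>\<close>

context
  fixes \<mu> :: "('x::topological_space \<Rightarrow>\<^sub>C complex) \<Rightarrow> complex"
  assumes \<mu>: "\<mu> \<in> dual_space UNIV"
begin

lemma dual_add: "\<mu> (f + g) = \<mu> f + \<mu> g"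
  and dual_scale: "\<mu> (scaleC_bcontfun c f) = c * \<mu> f"
  using \<mu> by (auto simp: dual_space_def)

lemma dual_zero: "\<mu> 0 = 0"
  using dual_scale[of 0 0] by simp

lemma dual_diff: "\<mu> (f - g) = \<mu> f - \<mu> g"
  using dual_add[of "f - g" g] by simp

lemma dual_sum: "\<mu> (\<Sum>i\<in>I. f i) = (\<Sum>i\<in>I. \<mu> (f i))"
  by (induction I rule: infinite_finite_induct) (auto simp: dual_zero dual_add)

lemma dual_bound: obtains K where "K > 0" "\<And>f. cmod (\<mu> f) \<le> K * norm f"
proof -
  obtain K where K: "\<And>f. cmod (\<mu> f) \<le> K * norm f"
    using \<mu> by (auto simp: dual_space_def)
  have "cmod (\<mu> f) \<le> (\<bar>K\<bar> + 1) * norm f" for f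
    by (rule order_trans[OF K mult_right_mono]) auto
  then show thesis by (intro that[of "\<bar>K\<bar> + 1"]) auto
qed

lemma dual_continuous: "continuous_on UNIV \<mu>"
proof -
  obtain K where K: "K > 0" "\<And>f. cmod (\<mu> f) \<le> K * norm f"
    using dual_bound by blast
  have "dist (\<mu> g) (\<mu> f) \<le> K * dist g f" for f g
    using K(2)[of "g - f"] by (simp add: dual_diff dist_norm)
  then have "\<exists>d>0. \<forall>g. dist g f < d \<longrightarrow> dist (\<mu> g) (\<mu> f) < e" if "e > 0" for e f
    using K(1) that
    by (intro exI[of _ "e / K"]) (auto simp: field_simps intro: le_less_trans)
  then show ?thesis by (auto simp: continuous_on_iff)
qed

end

lemma dual_spaceI:
  assumes "\<And>f g. \<mu> (f + g) = \<mu> f + \<mu> g" "\<And>c f. \<mu> (scaleC_bcontfun c f) = c * \<mu> f"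
    and "\<And>f. cmod (\<mu> f) \<le> K * norm f"
  shows "\<mu> \<in> dual_space UNIV"
  using assms by (auto simp: dual_space_def)

section \<open>Slices and partial integration\<close>

context
  includes bcontfun.lifting
begin

lift_definition slice_fst ::
    "(('x::topological_space \<times> 'y::topological_space) \<Rightarrow>\<^sub>C complex) \<Rightarrow> 'x \<Rightarrow> ('y \<Rightarrow>\<^sub>C complex)"
  is "\<lambda>F x y. F (x, y)"
  by (rule bcontfun_comp) (auto intro!: continuous_intros)

lift_definition slice_snd ::
    "(('x::topological_space \<times> 'y::topological_space) \<Rightarrow>\<^sub>C complex) \<Rightarrow> 'y \<Rightarrow> ('x \<Rightarrow>\<^sub>C complex)"
  is "\<lambda>F y x. F (x, y)"
  by (rule bcontfun_comp) (auto intro!: continuous_intros)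

lift_definition swap_bcontfun ::
    "(('x::topological_space \<times> 'y::topological_space) \<Rightarrow>\<^sub>C complex) \<Rightarrow> (('y \<times> 'x) \<Rightarrow>\<^sub>C complex)"
  is "\<lambda>F p. F (snd p, fst p)"
  by (rule bcontfun_comp) (auto intro!: continuous_intros)

end

lemmas [simp] = slice_fst.rep_eq slice_snd.rep_eq swap_bcontfun.rep_eq

lemma slice_fst_comult [simp]: "slice_fst (comult f) g = left_translate g f"
  and slice_snd_comult [simp]: "slice_snd (comult f) g = right_translate g f"
  by (auto intro!: bcontfun_eqI)

text \<open>The tube lemma: compactness of the other factor gives one neighbourhood of
  \<open>x0\<close> that works for all \<open>y\<close>, so pointwise continuity becomes continuity
  in the sup-norm. For \<open>comult f\<close> this is the norm continuity of the translation orbits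
  of \<open>f\<close>.\<close>

lemma continuous_slice_fst:
  fixes F :: "('x::topological_space \<times> 'y::topological_space) \<Rightarrow>\<^sub>C complex"
  assumes "compact (UNIV :: 'y set)"
  shows "continuous_on UNIV (slice_fst F)"
  unfolding continuous_on_def
proof (intro ballI tendstoI)
  fix x0 :: 'x and e :: real assume "e > 0"
  then have "e / 2 > 0" by simp
  then obtain X0 where X0: "x0 \<in> X0" "open X0"
    "\<forall>x\<in>X0. \<forall>t. dist (F (x, t)) (F (x0, t)) \<le> e / 2"
    using continuous_on_prod_compactE[OF continuous_on_apply_bcontfun[of _ F] assms UNIV_I]
    by (metis IntI UNIV_I)
  have "dist (slice_fst F x) (slice_fst F x0) < e" if "x \<in> X0" for x
  proof -
    have "dist (slice_fst F x) (slice_fst F x0) \<le> e / 2"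
      by (rule dist_bound) (use X0 that in auto)
    with \<open>e > 0\<close> show ?thesis by simp
  qed
  then show "\<forall>\<^sub>F x in at x0 within UNIV. dist (slice_fst F x) (slice_fst F x0) < e"
    using X0 by (auto simp: eventually_at_topological)
qed

lemma continuous_slice_snd:
  fixes F :: "('x::topological_space \<times> 'y::topological_space) \<Rightarrow>\<^sub>C complex"
  assumes "compact (UNIV :: 'x set)"
  shows "continuous_on UNIV (slice_snd F)"
proof -
  have "slice_snd F = slice_fst (swap_bcontfun F)"
    by (intro ext bcontfun_eqI) simp
  then show ?thesis using continuous_slice_fst[OF assms] by metis
qed

text \<open>Shaped so that \<open>convolution \<mu> \<nu> f\<close> is literally
  \<open>\<nu>\<close> of the partial integral of \<open>comult f\<close>. The value of
  \<open>Bcontfun\<close> is meaningful only once its argument is known to be bounded and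
  continuous, which is the content of \<open>partial_integral_apply\<close>.\<close>

definition partial_integral ::
    "(('x::topological_space \<Rightarrow>\<^sub>C complex) \<Rightarrow> complex) \<Rightarrow> (('x \<times> 'y::topological_space) \<Rightarrow>\<^sub>C complex)
      \<Rightarrow> ('y \<Rightarrow>\<^sub>C complex)" where
  "partial_integral \<mu> F = Bcontfun (\<lambda>y. \<mu> (slice_snd F y))"

lemma convolution_partial_integral: "convolution \<mu> \<nu> f = \<nu> (partial_integral \<mu> (comult f))"
  by (simp add: convolution_def partial_integral_def)

lemma partial_integral_apply:
  fixes \<mu> :: "('x::topological_space \<Rightarrow>\<^sub>C complex) \<Rightarrow> complex"
  assumes "compact (UNIV :: 'x set)" "\<mu> \<in> dual_space UNIV"
  shows "partial_integral \<mu> F y = \<mu> (slice_snd F y)"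
proof -
  obtain K where K: "K > 0" "\<And>f. cmod (\<mu> f) \<le> K * norm f"
    using dual_bound[OF assms(2)] by blast
  have "norm (slice_snd F y) \<le> norm F" for y
    by (rule norm_bound) (simp add: norm_bounded)
  then have "cmod (\<mu> (slice_snd F y)) \<le> K * norm F" for y
    by (rule order_trans[OF K(2) mult_left_mono]) (use K(1) in auto)
  moreover have "continuous_on UNIV (\<lambda>y. \<mu> (slice_snd F y))"
    using continuous_on_compose2[OF dual_continuous[OF assms(2)] continuous_slice_snd[OF assms(1)]]
    by auto
  ultimately have "(\<lambda>y. \<mu> (slice_snd F y)) \<in> bcontfun"
    by (rule bcontfun_normI[rotated])
  then show ?thesis by (simp add: partial_integral_def Bcontfun_inverse)
qed

text \<open>A partition of unity subordinate to a finite cover on whose members \<open>F (x, \<sqdot>)\<close> is nearly constant.\<close>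

lemma slice_fst_approx:
  fixes F :: "('x::topological_space \<times> 'y::topological_space) \<Rightarrow>\<^sub>C complex"
  assumes cX: "compact (UNIV :: 'x set)" and cY: "compact (UNIV :: 'y set)" and "e > 0"
  obtains I and p :: "'x \<Rightarrow> ('x \<Rightarrow>\<^sub>C complex)" where "finite I"
    "\<And>x y. cmod (F (x, y) - (\<Sum>i\<in>I. p i x * F (i, y))) \<le> e"
proof -
  note [continuous_intros] = continuous_slice_fst[OF cY, of F]
  obtain I where I: "finite I" "\<And>x. \<exists>i\<in>I. dist (slice_fst F x) (slice_fst F i) < e"
    using finite_net_of_compact[OF cX continuous_slice_fst[OF cY] \<open>e > 0\<close>, of F] by metis
  \<comment> \<open>Tent functions in the distance between slices: \<open>w i x\<close> is positive
    only if the slices at \<open>x\<close> and \<open>i\<close> differ by less than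
    \<open>e\<close>, and for each \<open>x\<close> some net point gives a positive value.\<close>
  define w where "w i x = max 0 (e - dist (slice_fst F x) (slice_fst F i))" for i x
  define s where "s x = (\<Sum>i\<in>I. w i x)" for x
  have s: "s x > 0" for x
  proof -
    obtain i where "i \<in> I" "dist (slice_fst F x) (slice_fst F i) < e" using I by blast
    then show ?thesis unfolding s_def
      by (intro sum_pos2[of I i]) (auto simp: I w_def)
  qed
  have cw: "continuous_on UNIV (w i)" for i
    unfolding w_def by (intro continuous_intros)
  have cs: "continuous_on UNIV s"
    unfolding s_def by (intro continuous_intros cw)
  define p where "p i = Bcontfun (\<lambda>x. complex_of_real (w i x / s x))" for i
  have p: "p i x = complex_of_real (w i x / s x)" for i x
  proof -
    have "(\<lambda>x. complex_of_real (w i x / s x)) \<in> bcontfun"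
      by (intro compact_UNIV_bcontfunI cX continuous_on_of_real continuous_on_divide cw cs)
        (use s in \<open>auto simp: less_imp_neq[symmetric]\<close>)
    then show ?thesis by (simp add: p_def Bcontfun_inverse)
  qed
  have sum1: "(\<Sum>i\<in>I. w i x / s x) = 1" for x
    using s[of x] by (simp add: sum_divide_distrib[symmetric] s_def)
  have "cmod (F (x, y) - (\<Sum>i\<in>I. p i x * F (i, y))) \<le> e" for x y
  proof -
    have "F (x, y) = (\<Sum>i\<in>I. p i x * F (x, y))"
      using sum1[of x] by (simp only: p sum_distrib_right[symmetric] of_real_sum[symmetric]) simp
    then have "cmod (F (x, y) - (\<Sum>i\<in>I. p i x * F (i, y)))
        = cmod (\<Sum>i\<in>I. p i x * (F (x, y) - F (i, y)))"
      by (simp add: sum_subtractf algebra_simps)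
    also have "\<dots> \<le> (\<Sum>i\<in>I. w i x / s x * e)"
    proof (rule sum_norm_le)
      fix i assume "i \<in> I"
      have w0: "0 \<le> w i x" by (simp add: w_def)
      have "w i x * dist (F (x, y)) (F (i, y)) \<le> w i x * e"
      proof (cases "w i x = 0")
        case False
        then have "dist (slice_fst F x) (slice_fst F i) < e" by (auto simp: w_def max_def split: if_splits)
        from dist_fun_lt_imp_dist_val_lt[OF this, of y] w0 show ?thesis
          by (intro mult_left_mono) auto
      qed auto
      then show "cmod (p i x * (F (x, y) - F (i, y))) \<le> w i x / s x * e"
        using s[of x] w0 by (simp add: p norm_mult dist_norm norm_divide divide_right_mono)
    qed
    also have "\<dots> = e" using sum1[of x] by (simp only: sum_distrib_right[symmetric] mult_1)
    finally show ?thesis .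
  qed
  with I(1) show thesis by (rule that)
qed

text \<open>Applying \<open>\<mu>\<close> in the first variable to the approximation by
  \<open>p i x * F (i, y)\<close> leaves a linear combination of slices of \<open>F\<close> with
  coefficients \<open>\<mu> (p i)\<close>. The weights may lie outside \<open>A\<close>, but only
  these numbers survive. The tolerance \<open>e / K\<close> absorbs the norm of
  \<open>\<mu>\<close>.\<close>

lemma partial_integral_in_subspace:
  fixes F :: "('x::topological_space \<times> 'y::topological_space) \<Rightarrow>\<^sub>C complex"
  assumes cX: "compact (UNIV :: 'x set)" and cY: "compact (UNIV :: 'y set)"
    and \<mu>: "\<mu> \<in> dual_space UNIV" and A: "closed A" "cfun.subspace A"
    and F: "\<And>x. slice_fst F x \<in> A"
  shows "partial_integral \<mu> F \<in> A"
proof (rule closed_mem_of_approx[OF A(1)])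
  fix e :: real assume "e > 0"
  obtain K where K: "K > 0" "\<And>f. cmod (\<mu> f) \<le> K * norm f"
    using dual_bound[OF \<mu>] by blast
  with \<open>e > 0\<close> have "e / K > 0" by simp
  from slice_fst_approx[OF cX cY this, of F] obtain I and p :: "'x \<Rightarrow> ('x \<Rightarrow>\<^sub>C complex)"
    where I: "finite I"
    "\<And>x y. cmod (F (x, y) - (\<Sum>i\<in>I. p i x * F (i, y))) \<le> e / K" by metis
  define g where "g = (\<Sum>i\<in>I. scaleC_bcontfun (\<mu> (p i)) (slice_fst F i))"
  have "g \<in> A"
    unfolding g_def by (intro cfun.subspace_sum cfun.subspace_scale A F)
  moreover have "norm (g - partial_integral \<mu> F) \<le> e"
  proof (rule norm_bound)
    fix y
    define h where "h = (\<Sum>i\<in>I. scaleC_bcontfun (F (i, y)) (p i))"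
    have h: "norm (h - slice_snd F y) \<le> e / K"
      by (rule norm_bound) (use I(2) in \<open>simp add: h_def mult.commute norm_minus_commute\<close>)
    have "cmod (\<mu> (h - slice_snd F y)) \<le> K * (e / K)"
      by (rule order_trans[OF K(2) mult_left_mono]) (use K in \<open>auto intro: h\<close>)
    moreover have "\<mu> h = g y"
      by (simp add: h_def g_def dual_sum[OF \<mu>] dual_scale[OF \<mu>] mult.commute)
    ultimately show "cmod ((g - partial_integral \<mu> F) y) \<le> e"
      using K(1) by (simp add: partial_integral_apply[OF cX \<mu>] dual_diff[OF \<mu>])
  qed
  ultimately show "\<exists>g\<in>A. norm (g - partial_integral \<mu> F) \<le> e" by blast
qed

section \<open>Complexification of real functionals\<close>

text \<open>A complex-linear functional is recovered from its real part \<open>U\<close>. The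
  rotation by \<open>d\<close> makes the value real and nonnegative, so bounds on \<open>U\<close>
  pass to \<open>\<psi>\<close> with the same constant. Used both for the Haar integral and for the
  Hahn-Banach theorem.\<close>

lemma complexified_functional:
  fixes U :: "('x::topological_space \<Rightarrow>\<^sub>C complex) \<Rightarrow> real"
  assumes add: "\<And>f g. U (f + g) = U f + U g" and scale: "\<And>r f. U (r *\<^sub>R f) = r * U f"
  defines "\<psi> \<equiv> \<lambda>f. Complex (U f) (- U (scaleC_bcontfun \<i> f))"
  shows "\<psi> (f + g) = \<psi> f + \<psi> g" and "\<psi> (scaleC_bcontfun c f) = c * \<psi> f"
    and "\<exists>d. cmod d = 1 \<and> cmod (\<psi> f) = U (scaleC_bcontfun d f)"
proof -
  have expand: "U (scaleC_bcontfun d f) = Re d * U f + Im d * U (scaleC_bcontfun \<i> f)" for d f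
  proof -
    have "scaleC_bcontfun d f = Re d *\<^sub>R f + Im d *\<^sub>R scaleC_bcontfun \<i> f"
      by (rule bcontfun_eqI) (simp add: complex_eq_iff)
    then show ?thesis by (simp add: add scale)
  qed
  show "\<psi> (f + g) = \<psi> f + \<psi> g"
    by (simp add: \<psi>_def add complex_eq_iff cfun.scale_right_distrib)
  show hom: "\<psi> (scaleC_bcontfun c f) = c * \<psi> f" for c f
    using expand[of c f] expand[of "\<i> * c" f] by (simp add: \<psi>_def complex_eq_iff)
  show "\<exists>d. cmod d = 1 \<and> cmod (\<psi> f) = U (scaleC_bcontfun d f)"
  proof (cases "\<psi> f = 0")
    case True
    then show ?thesis by (intro exI[of _ 1]) (auto simp: \<psi>_def complex_eq_iff)
  next
    case False
    define d where "d = of_real (cmod (\<psi> f)) / \<psi> f"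
    have "\<psi> (scaleC_bcontfun d f) = of_real (cmod (\<psi> f))"
      using False by (simp add: hom d_def)
    from arg_cong[OF this, of Re] have "cmod (\<psi> f) = U (scaleC_bcontfun d f)"
      by (simp add: \<psi>_def)
    moreover have "cmod d = 1" using False by (simp add: d_def norm_divide)
    ultimately show ?thesis by blast
  qed
qed

section \<open>The invariant mean\<close>

lemma sum_list_swap:
  fixes h :: "'a \<Rightarrow> 'b \<Rightarrow> 'c::comm_monoid_add"
  shows "(\<Sum>x\<leftarrow>xs. \<Sum>y\<leftarrow>ys. h x y) = (\<Sum>y\<leftarrow>ys. \<Sum>x\<leftarrow>xs. h x y)"
  by (induction xs) (simp_all add: sum_list_addf)

lemma sum_list_product_map:
  fixes h :: "'a \<Rightarrow> 'b \<Rightarrow> 'c::comm_monoid_add"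
  shows "(\<Sum>p\<leftarrow>List.product xs ys. h (fst p) (snd p)) = (\<Sum>x\<leftarrow>xs. \<Sum>y\<leftarrow>ys. h x y)"
  by (induction xs) (simp_all add: comp_def)

lemma sum_list_le_length:
  fixes h :: "'a \<Rightarrow> real"
  shows "(\<And>x. x \<in> set xs \<Longrightarrow> h x \<le> b) \<Longrightarrow> (\<Sum>x\<leftarrow>xs. h x) \<le> real (length xs) * b"
  by (induction xs) (auto simp: algebra_simps intro: add_mono)

text \<open>One entry is known to be at most \<open>a\<close>, all others only at most
  \<open>b\<close>: this is the gain by which a further average lowers the maximum in
  \<open>ex_real_mean\<close>.\<close>

lemma sum_list_le_one_small:
  fixes h :: "'a \<Rightarrow> real"
  assumes "y \<in> set xs" "h y \<le> a" "\<And>x. x \<in> set xs \<Longrightarrow> h x \<le> b"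
  shows "(\<Sum>x\<leftarrow>xs. h x) \<le> (real (length xs) - 1) * b + a"
proof -
  obtain us vs where xs: "xs = us @ y # vs" using split_list[OF assms(1)] by blast
  have "(\<Sum>x\<leftarrow>us. h x) \<le> real (length us) * b" "(\<Sum>x\<leftarrow>vs. h x) \<le> real (length vs) * b"
    using assms(3) by (auto intro!: sum_list_le_length simp: xs)
  with assms(2) show ?thesis by (simp add: xs algebra_simps)
qed

lemma average_close:
  fixes h :: "'a \<Rightarrow> real"
  assumes "xs \<noteq> []" "\<And>x. x \<in> set xs \<Longrightarrow> \<bar>h x - c\<bar> \<le> e"
  shows "\<bar>(\<Sum>x\<leftarrow>xs. h x) / real (length xs) - c\<bar> \<le> e"
proof -
  have n: "real (length xs) > 0" using assms(1) by simp
  have "h x \<le> c + e" "- h x \<le> e - c" if "x \<in> set xs" for x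
    using assms(2)[OF that] by auto
  then have "(\<Sum>x\<leftarrow>xs. h x) \<le> real (length xs) * (c + e)"
    "(\<Sum>x\<leftarrow>xs. - h x) \<le> real (length xs) * (e - c)"
    by (auto intro!: sum_list_le_length)
  moreover have "(\<Sum>x\<leftarrow>xs. - h x) = - (\<Sum>x\<leftarrow>xs. h x)" by (induction xs) auto
  ultimately have "(\<Sum>x\<leftarrow>xs. h x) / real (length xs) \<le> c + e"
    "- (\<Sum>x\<leftarrow>xs. h x) / real (length xs) \<le> e - c"
    using n by (auto simp: field_simps)
  then show ?thesis by auto
qed

lemma Re_sum_list: "Re (\<Sum>x\<leftarrow>xs. h x) = (\<Sum>x\<leftarrow>xs. Re (h x))"
  by (induction xs) auto

lemma apply_bcontfun_sum_list:
  fixes f :: "'i \<Rightarrow> ('x::topological_space \<Rightarrow>\<^sub>C complex)"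
  shows "apply_bcontfun (\<Sum>i\<leftarrow>I. f i) x = (\<Sum>i\<leftarrow>I. apply_bcontfun (f i) x)"
  by (induction I) auto

text \<open>Averages run over lists, not finite sets: when two averages are composed, different
  pairs may have the same sum and must be counted with multiplicity.\<close>

definition left_average ::
    "'g::topological_group_add list \<Rightarrow> ('g \<Rightarrow>\<^sub>C complex) \<Rightarrow> ('g \<Rightarrow>\<^sub>C complex)" where
  "left_average S f = scaleC_bcontfun (1 / of_nat (length S)) (\<Sum>s\<leftarrow>S. left_translate s f)"

definition right_average ::
    "'g::topological_group_add list \<Rightarrow> ('g \<Rightarrow>\<^sub>C complex) \<Rightarrow> ('g \<Rightarrow>\<^sub>C complex)" where
  "right_average S f = scaleC_bcontfun (1 / of_nat (length S)) (\<Sum>s\<leftarrow>S. right_translate s f)"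

lemma left_average_apply: "left_average S f x = (\<Sum>s\<leftarrow>S. f (s + x)) / of_nat (length S)"
  and right_average_apply: "right_average S f x = (\<Sum>s\<leftarrow>S. f (x + s)) / of_nat (length S)"
  by (simp_all add: left_average_def right_average_def apply_bcontfun_sum_list)

lemma Re_left_average: "Re (left_average S f x) = (\<Sum>s\<leftarrow>S. Re (f (s + x))) / real (length S)"
  and Re_right_average: "Re (right_average S f x) = (\<Sum>s\<leftarrow>S. Re (f (x + s))) / real (length S)"
  by (simp_all add: left_average_apply right_average_apply Re_sum_list Re_divide_of_nat)

lemma left_average_add: "left_average S (f + g) = left_average S f + left_average S g"
  by (rule bcontfun_eqI) (simp add: left_average_apply sum_list_addf add_divide_distrib)

lemma left_average_diff: "left_average S (f - g) = left_average S f - left_average S g"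
  using left_average_add[of S "f - g" g] by simp

lemma left_average_scaleR: "left_average S (r *\<^sub>R f) = r *\<^sub>R left_average S f"
  by (rule bcontfun_eqI) (simp add: left_average_apply scaleR_conv_of_real sum_list_const_mult)

lemma ex_left_average_left_average:
  fixes S T :: "'g::topological_group_add list"
  assumes "S \<noteq> []" "T \<noteq> []"
  shows "\<exists>R. R \<noteq> [] \<and> (\<forall>f. left_average T (left_average S f) = left_average R f)"
proof (intro exI conjI allI)
  \<comment> \<open>The composite evaluates \<open>f\<close> at \<open>s + (t + x)\<close>, so the
    pair \<open>(t, s)\<close> contributes \<open>s + t\<close>; the order matters in a
    noncommutative group.\<close>
  define R where "R = map (\<lambda>p. snd p + fst p) (List.product T S)"
  show "R \<noteq> []" using assms by (cases T; cases S) (auto simp: R_def)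
  show "left_average T (left_average S f) = left_average R f" for f
  proof (rule bcontfun_eqI)
    fix x
    show "left_average T (left_average S f) x = left_average R f x"
      using sum_list_product_map[of "\<lambda>t s. f (s + (t + x))" T S]
      by (simp add: left_average_apply R_def comp_def add.assoc divide_inverse sum_list_mult_const
          sum_list_const_mult mult_ac)
  qed
qed

lemma left_average_right_average:
  fixes f :: "'g::topological_group_add \<Rightarrow>\<^sub>C complex"
  shows "left_average S (right_average T f) = right_average T (left_average S f)"
proof (rule bcontfun_eqI)
  fix x
  have "left_average S (right_average T f) x
      = (\<Sum>s\<leftarrow>S. \<Sum>t\<leftarrow>T. f (s + x + t)) * (1 / (of_nat (length S) * of_nat (length T)))"
    by (simp add: left_average_apply right_average_apply divide_inverse sum_list_mult_const sum_list_const_mult mult_ac)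
  also have "(\<Sum>s\<leftarrow>S. \<Sum>t\<leftarrow>T. f (s + x + t)) = (\<Sum>t\<leftarrow>T. \<Sum>s\<leftarrow>S. f (s + (x + t)))"
    unfolding add.assoc by (rule sum_list_swap)
  also have "\<dots> * (1 / (of_nat (length S) * of_nat (length T))) = right_average T (left_average S f) x"
    by (simp add: left_average_apply right_average_apply divide_inverse sum_list_mult_const sum_list_const_mult mult_ac)
  finally show "left_average S (right_average T f) x = right_average T (left_average S f) x" .
qed

lemma left_average_right_translate:
  "left_average S (right_translate h f) = right_translate h (left_average S f)"
  by (rule bcontfun_eqI) (simp add: left_average_apply add.assoc)

text \<open>Restricted to real parts because the existence proof compares maxima and so needs an
  order; the complex functional is assembled afterwards.\<close>

definition real_mean :: "('g::topological_group_add \<Rightarrow>\<^sub>C complex) \<Rightarrow> real \<Rightarrow> bool" where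
  "real_mean f c \<longleftrightarrow> (\<forall>e>0. \<exists>S. S \<noteq> [] \<and> (\<forall>x. \<bar>Re (left_average S f x) - c\<bar> \<le> e))"

lemma real_meanE:
  assumes "real_mean f c" "e > 0"
  obtains S where "S \<noteq> []" "\<And>x. \<bar>Re (left_average S f x) - c\<bar> \<le> e"
  using assms unfolding real_mean_def by metis

lemma left_average_close:
  fixes f :: "'g::topological_group_add \<Rightarrow>\<^sub>C complex"
  assumes "S \<noteq> []" "\<And>x. \<bar>Re (f x) - c\<bar> \<le> e"
  shows "\<bar>Re (left_average S f x) - c\<bar> \<le> e"
  unfolding Re_left_average by (rule average_close) (use assms in auto)

lemma right_average_close:
  fixes f :: "'g::topological_group_add \<Rightarrow>\<^sub>C complex"
  assumes "S \<noteq> []" "\<And>x. \<bar>Re (f x) - c\<bar> \<le> e"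
  shows "\<bar>Re (right_average S f x) - c\<bar> \<le> e"
  unfolding Re_right_average by (rule average_close) (use assms in auto)

text \<open>An average of an average is an average. Together with uniqueness this makes the mean
  invariant under left averaging, which is what additivity rests on.\<close>

lemma real_mean_left_average:
  assumes "S \<noteq> []" "real_mean (left_average S f) c"
  shows "real_mean f c"
  unfolding real_mean_def
proof (intro allI impI)
  fix e :: real assume "e > 0"
  with assms(2) obtain T where T: "T \<noteq> []" "\<And>x. \<bar>Re (left_average T (left_average S f) x) - c\<bar> \<le> e"
    using real_meanE by metis
  with ex_left_average_left_average[OF assms(1) T(1)]
  show "\<exists>S. S \<noteq> [] \<and> (\<forall>x. \<bar>Re (left_average S f x) - c\<bar> \<le> e)" by metis
qed

context
  includes bcontfun.lifting
begin

lift_definition reflect_bcontfun ::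
    "('g::topological_group_add \<Rightarrow>\<^sub>C complex) \<Rightarrow> ('g \<Rightarrow>\<^sub>C complex)"
  is "\<lambda>f x. f (- x)"
  by (rule bcontfun_comp) (auto intro!: continuous_intros)

lift_definition cnj_bcontfun ::
    "('x::topological_space \<Rightarrow>\<^sub>C complex) \<Rightarrow> ('x \<Rightarrow>\<^sub>C complex)"
  is "\<lambda>f x. cnj (f x)"
  by (auto simp: bcontfun_def bounded_iff intro!: continuous_intros)

end

lemmas [simp] = reflect_bcontfun.rep_eq cnj_bcontfun.rep_eq

context
  assumes compact_group: "compact (UNIV :: 'g::topological_group_add set)"
begin

text \<open>
  The constant is the infimum \<open>c\<close> of the maxima of left averages. An average \<open>F\<close> whose maximum is
  close to \<open>c\<close> cannot be small anywhere: by equicontinuity it would be small on a translate of a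
  neighbourhood \<open>U\<close> that does not depend on \<open>F\<close>, and averaging \<open>F\<close> once more over a cover of
  the group by translates of \<open>U\<close> would bring the maximum below \<open>c\<close>.
\<close>

lemma ex_real_mean:
  fixes f :: "'g \<Rightarrow>\<^sub>C complex"
  shows "\<exists>c. real_mean f c"
proof -
  define P where "P = {b. \<exists>S. S \<noteq> [] \<and> (\<forall>x. Re (left_average S f x) \<le> b)}"
  have bound: "\<bar>Re (left_average S f x)\<bar> \<le> norm f" if "S \<noteq> []" for S x
    using left_average_close[OF that, of f 0 "norm f" x]
      abs_Re_le_cmod norm_bounded order_trans by fastforce
  have "norm f \<in> P"
    unfolding P_def using bound[of "[0]"] by (auto intro!: exI[of _ "[0]"] simp: abs_le_iff)
  have bdd: "bdd_below P"
  proof (rule bdd_belowI[of _ "- norm f"])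
    fix b assume "b \<in> P"
    then obtain S where "S \<noteq> []" "Re (left_average S f 0) \<le> b" by (auto simp: P_def)
    with bound[of S 0] show "- norm f \<le> b" by linarith
  qed
  define c where "c = Inf P"
  have "\<exists>S. S \<noteq> [] \<and> (\<forall>x. \<bar>Re (left_average S f x) - c\<bar> \<le> e)" if "e > 0" for e
  proof -
    define U where "U = {u. dist (right_translate u f) f < e / 3}"
    have "continuous_on UNIV (\<lambda>u. right_translate u f)"
      using continuous_slice_snd[OF compact_group, of "comult f"] by simp
    then have "open U"
      unfolding U_def by (intro open_Collect_less continuous_intros)
    define V where "V s = (\<lambda>x. - s + x) -` U" for s
    have "open (V s)" for s
      unfolding V_def by (rule open_vimage[OF \<open>open U\<close>]) (intro continuous_intros)
    moreover have "right_translate 0 f = f"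
      by (rule bcontfun_eqI) simp
    then have "0 \<in> U" using \<open>e > 0\<close> by (simp add: U_def)
    then have "x \<in> V x" for x by (simp add: V_def)
    then have "UNIV \<subseteq> (\<Union>s. V s)" by auto
    ultimately obtain I where I: "finite I" "UNIV \<subseteq> (\<Union>s\<in>I. V s)"
      using compactE_image[OF compact_group, of UNIV V] by (metis UNIV_I subset_UNIV)
    obtain L where L: "set L = I" using finite_list[OF I(1)] by blast
    have "L \<noteq> []" using I(2) L by auto
    define n where "n = real (length L)"
    have n: "n \<ge> 1" unfolding n_def using \<open>L \<noteq> []\<close> by (cases L) auto
    \<comment> \<open>The excess is tuned to the count below: \<open>n - 1\<close> terms at most
      \<open>c + e / (3 * n)\<close> and one at most \<open>c - 2 * e / 3\<close> have average at
      most \<open>c - e / (3 * n)\<close>, which contradicts the choice of \<open>c\<close>. The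
      cover, and hence \<open>n\<close>, is fixed before \<open>S\<close>.\<close>
    have "c < c + e / (3 * n)" using \<open>e > 0\<close> n by simp
    then obtain b where "b \<in> P" "b < c + e / (3 * n)"
      unfolding c_def using cInf_lessD[of P] \<open>norm f \<in> P\<close> by blast
    then obtain S where S: "S \<noteq> []" "\<And>x. Re (left_average S f x) \<le> c + e / (3 * n)"
      unfolding P_def by (smt (verit) mem_Collect_eq)
    define F where "F = left_average S f"
    \<comment> \<open>Left averaging commutes with right translation and does not increase the sup
      of the real part, so every left average inherits from \<open>f\<close> the same neighbourhood
      \<open>U\<close>.\<close>
    have unif: "\<bar>Re (F (x + u)) - Re (F x)\<bar> \<le> e / 3" if "u \<in> U" for x u
    proof -
      have "\<bar>Re ((right_translate u f - f) x) - 0\<bar> \<le> e / 3" for x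
        using that dist_bounded[of "right_translate u f" x f] abs_Re_le_cmod[of "f (x + u) - f x"]
        by (simp add: U_def dist_norm)
      from left_average_close[OF S(1), OF this, of x] show ?thesis
        by (simp add: F_def left_average_diff left_average_right_translate)
    qed
    have "Re (F x0) \<ge> c - e" for x0
    proof (rule ccontr)
      assume "\<not> Re (F x0) \<ge> c - e"
      then have small: "Re (F x0) < c - e" by simp
      \<comment> \<open>If \<open>x\<close> lies in the translate of \<open>U\<close> by
        \<open>s\<close>, then \<open>x0 + - s + x\<close> lies in the translate of \<open>U\<close>
        by \<open>x0\<close>, where \<open>F\<close> is small. As these translates cover the group,
        every \<open>x\<close> meets a small term.\<close>
      define T where "T = map (\<lambda>s. x0 + - s) L"
      have "T \<noteq> []" and lT: "length T = length L" using \<open>L \<noteq> []\<close> by (auto simp: T_def)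
      have "Re (left_average T F x) \<le> c - e / (3 * n)" for x
      proof -
        obtain s where s: "s \<in> set L" "- s + x \<in> U" using I(2) L by (auto simp: V_def)
        have "Re (F (x0 + - s + x)) \<le> c - 2 * e / 3"
          using unif[OF s(2), of x0] small unfolding add.assoc by linarith
        moreover have "x0 + - s \<in> set T" using s by (auto simp: T_def)
        ultimately have "(\<Sum>t\<leftarrow>T. Re (F (t + x)))
            \<le> (real (length T) - 1) * (c + e / (3 * n)) + (c - 2 * e / 3)"
          using S(2) by (intro sum_list_le_one_small[of "x0 + - s"]) (auto simp: F_def)
        also have "\<dots> = n * c - e / 3 - e / (3 * n)"
          using n by (simp add: lT flip: n_def) (simp add: field_simps)
        also have "\<dots> \<le> n * (c - e / (3 * n))"
          using n \<open>e > 0\<close> by (simp add: field_simps)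
        finally have "(\<Sum>t\<leftarrow>T. Re (F (t + x))) / n \<le> c - e / (3 * n)"
          using n by (subst pos_divide_le_eq) (auto simp only: mult.commute)
        then show ?thesis by (simp only: Re_left_average lT n_def)
      qed
      moreover obtain R where R: "R \<noteq> []" "\<And>f. left_average T (left_average S f) = left_average R f"
        using ex_left_average_left_average[OF S(1) \<open>T \<noteq> []\<close>] by metis
      ultimately have "c - e / (3 * n) \<in> P"
        unfolding P_def F_def R(2) using R(1) by blast
      then have "c \<le> c - e / (3 * n)" unfolding c_def using bdd by (rule cInf_lower)
      moreover have "e / (3 * n) > 0" using n \<open>e > 0\<close> by simp
      ultimately show False by linarith
    qed
    moreover have "e / (3 * n) \<le> e" using n \<open>e > 0\<close> by (simp add: field_simps)
    then have "Re (F x) \<le> c + e" for x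
      using S(2)[of x] by (simp add: F_def)
    ultimately show ?thesis
      using S(1) by (intro exI[of _ S]) (auto simp: F_def abs_le_iff algebra_simps)
  qed
  then show ?thesis unfolding real_mean_def by blast
qed

text \<open>Inversion exchanges left and right averages, so existence carries over from the
  reflected function.\<close>

lemma ex_right_real_mean:
  fixes f :: "'g \<Rightarrow>\<^sub>C complex"
  shows "\<exists>c. \<forall>e>0. \<exists>S. S \<noteq> [] \<and> (\<forall>x. \<bar>Re (right_average S f x) - c\<bar> \<le> e)"
proof -
  obtain c where c: "real_mean (reflect_bcontfun f) c" using ex_real_mean by blast
  have "right_average (map uminus S) f x = left_average S (reflect_bcontfun f) (- x)" for S x
    by (simp add: right_average_apply left_average_apply comp_def minus_add)
  then have "\<exists>S. S \<noteq> [] \<and> (\<forall>x. \<bar>Re (right_average S f x) - c\<bar> \<le> e)" if "e > 0" for e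
    using c that unfolding real_mean_def by (metis map_is_Nil_conv)
  then show ?thesis by blast
qed

text \<open>Left averages commute with right averages, so every left mean equals every right mean.\<close>

lemma real_mean_unique:
  fixes f :: "'g \<Rightarrow>\<^sub>C complex"
  assumes "real_mean f c" "real_mean f c'"
  shows "c = c'"
proof -
  obtain d where d: "\<forall>e>0. \<exists>S. S \<noteq> [] \<and> (\<forall>x. \<bar>Re (right_average S f x) - d\<bar> \<le> e)"
    using ex_right_real_mean by blast
  have "c = d" if "real_mean f c" for c
  proof -
    have "\<bar>c - d\<bar> \<le> e" if "e > 0" for e
    proof -
      have "e / 2 > 0" using that by simp
      then obtain S T where S: "S \<noteq> []" "\<And>x. \<bar>Re (left_average S f x) - c\<bar> \<le> e / 2"
        and T: "T \<noteq> []" "\<And>x. \<bar>Re (right_average T f x) - d\<bar> \<le> e / 2"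
        using d \<open>real_mean f c\<close> unfolding real_mean_def by metis
      have "\<bar>Re (right_average T (left_average S f) 0) - c\<bar> \<le> e / 2"
        by (rule right_average_close) (use S T in auto)
      moreover have "\<bar>Re (left_average S (right_average T f) 0) - d\<bar> \<le> e / 2"
        by (rule left_average_close) (use S T in auto)
      ultimately show ?thesis unfolding left_average_right_average by linarith
    qed
    from field_le_epsilon[of "\<bar>c - d\<bar>" 0] this show ?thesis by auto
  qed
  with assms show ?thesis by metis
qed

section \<open>Linearity, monotonicity and right invariance of the real mean\<close>

definition mean_Re :: "('g \<Rightarrow>\<^sub>C complex) \<Rightarrow> real" where
  "mean_Re f = (THE c. real_mean f c)"

lemma real_mean_mean_Re: "real_mean f (mean_Re f)"
  unfolding mean_Re_def using ex_real_mean real_mean_unique by (rule_tac theI') blast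

lemma mean_Re_eqI: "real_mean f c \<Longrightarrow> mean_Re f = c"
  using real_mean_mean_Re real_mean_unique by blast

text \<open>One list must serve both functions. Choose \<open>S\<close> for \<open>f\<close>, then
  \<open>T\<close> for the \<open>S\<close>-average of \<open>g\<close>, whose mean is still that of
  \<open>g\<close>. Averaging over \<open>T\<close> keeps the \<open>S\<close>-average of
  \<open>f\<close> close to its mean, so the composite works for both.\<close>

lemma mean_Re_add: "mean_Re (f + g) = mean_Re f + mean_Re g"
proof (rule mean_Re_eqI, unfold real_mean_def, intro allI impI)
  fix e :: real assume "e > 0"
  then have "e / 2 > 0" by simp
  then obtain S where S: "S \<noteq> []" "\<And>x. \<bar>Re (left_average S f x) - mean_Re f\<bar> \<le> e / 2"
    using real_meanE[OF real_mean_mean_Re] by metis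
  have "mean_Re g = mean_Re (left_average S g)"
    using real_mean_left_average[OF S(1) real_mean_mean_Re] by (rule mean_Re_eqI)
  then obtain T where T: "T \<noteq> []"
    "\<And>x. \<bar>Re (left_average T (left_average S g) x) - mean_Re g\<bar> \<le> e / 2"
    using real_meanE[OF real_mean_mean_Re \<open>e / 2 > 0\<close>] by metis
  have "\<bar>Re (left_average T (left_average S f) x) - mean_Re f\<bar> \<le> e / 2" for x
    by (rule left_average_close) (use S T in auto)
  note * = this T(2)
  have "\<bar>Re (left_average T (left_average S (f + g)) x) - (mean_Re f + mean_Re g)\<bar> \<le> e" for x
  proof -
    have "Re (left_average T (left_average S (f + g)) x)
        = Re (left_average T (left_average S f) x) + Re (left_average T (left_average S g) x)"
      by (simp add: left_average_add)
    then show ?thesis using *(1)[of x] *(2)[of x] by linarith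
  qed
  then show "\<exists>S. S \<noteq> [] \<and> (\<forall>x. \<bar>Re (left_average S (f + g) x) - (mean_Re f + mean_Re g)\<bar> \<le> e)"
    using ex_left_average_left_average[OF S(1) T(1)] by metis
qed

lemma mean_Re_scaleR: "mean_Re (r *\<^sub>R f) = r * mean_Re f"
proof (rule mean_Re_eqI, unfold real_mean_def, intro allI impI)
  fix e :: real assume "e > 0"
  then have "e / (\<bar>r\<bar> + 1) > 0" by simp
  then obtain S where S: "S \<noteq> []" "\<And>x. \<bar>Re (left_average S f x) - mean_Re f\<bar> \<le> e / (\<bar>r\<bar> + 1)"
    using real_meanE[OF real_mean_mean_Re] by metis
  have "\<bar>Re (left_average S (r *\<^sub>R f) x) - r * mean_Re f\<bar> \<le> e" for x
  proof -
    have "Re (left_average S (r *\<^sub>R f) x) - r * mean_Re f = r * (Re (left_average S f x) - mean_Re f)"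
      by (simp add: left_average_scaleR algebra_simps)
    then have "\<bar>Re (left_average S (r *\<^sub>R f) x) - r * mean_Re f\<bar>
        = \<bar>r\<bar> * \<bar>Re (left_average S f x) - mean_Re f\<bar>" by (simp add: abs_mult)
    also have "\<dots> \<le> \<bar>r\<bar> * (e / (\<bar>r\<bar> + 1))" by (intro mult_left_mono S) auto
    also have "\<dots> \<le> e" using \<open>e > 0\<close> by (simp add: field_simps)
    finally show ?thesis .
  qed
  with S(1) show "\<exists>S. S \<noteq> [] \<and> (\<forall>x. \<bar>Re (left_average S (r *\<^sub>R f) x) - r * mean_Re f\<bar> \<le> e)"
    by blast
qed

lemma mean_Re_mono:
  fixes f g :: "'g \<Rightarrow>\<^sub>C complex"
  assumes "\<And>x. Re (f x) \<le> Re (g x)"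
  shows "mean_Re f \<le> mean_Re g"
proof -
  define u where "u = g + (- 1) *\<^sub>R f"
  have u: "0 \<le> Re (u x)" for x using assms[of x] by (simp add: u_def)
  have "- mean_Re u \<le> 0 + e" if e: "e > 0" for e
  proof -
    obtain S where S: "S \<noteq> []" "\<And>x. \<bar>Re (left_average S u x) - mean_Re u\<bar> \<le> e"
      using real_meanE[OF real_mean_mean_Re e] by metis
    have "0 \<le> Re (left_average S u 0)"
      unfolding Re_left_average by (intro divide_nonneg_nonneg sum_list_nonneg) (auto simp: u)
    with S(2)[of 0] show ?thesis by linarith
  qed
  then have "0 \<le> mean_Re u" using field_le_epsilon[of "- mean_Re u" 0] by simp
  then show ?thesis unfolding u_def mean_Re_add mean_Re_scaleR by simp
qed

lemma mean_Re_const: "mean_Re (const_bcontfun c) = Re c"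
proof (rule mean_Re_eqI)
  have "left_average [0] (const_bcontfun c) x = c" for x :: 'g
    by (simp add: left_average_apply const_bcontfun.rep_eq)
  then show "real_mean (const_bcontfun c :: 'g \<Rightarrow>\<^sub>C complex) (Re c)"
    unfolding real_mean_def by (auto intro!: exI[of _ "[0]"])
qed

text \<open>The same lists work, because left averages commute with right translations and the
  defining estimate is uniform in the point. This invariance later makes the L2 seminorm blind to
  right translation.\<close>

lemma mean_Re_right_translate: "mean_Re (right_translate h f) = mean_Re f"
proof (rule mean_Re_eqI)
  show "real_mean (right_translate h f) (mean_Re f)"
    using real_mean_mean_Re[of f]
    unfolding real_mean_def left_average_right_translate right_translate.rep_eq by blast
qed

section \<open>The normalized Haar integral as a complex functional\<close>

definition haar :: "('g \<Rightarrow>\<^sub>C complex) \<Rightarrow> complex" where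
  "haar f = Complex (mean_Re f) (- mean_Re (scaleC_bcontfun \<i> f))"

lemmas haar_linear = complexified_functional[of mean_Re, OF mean_Re_add mean_Re_scaleR, folded haar_def]

text \<open>After a rotation by a unit scalar the modulus of the integral is the mean of a real
  part, which lies pointwise below that of \<open>g\<close>; monotonicity then applies. It plays the
  role of the triangle inequality for integrals.\<close>

lemma haar_bound:
  fixes f g :: "'g \<Rightarrow>\<^sub>C complex"
  assumes "\<And>x. cmod (f x) \<le> Re (g x)"
  shows "cmod (haar f) \<le> Re (haar g)"
proof -
  obtain d where d: "cmod d = 1" "cmod (haar f) = mean_Re (scaleC_bcontfun d f)"
    using haar_linear(3) by blast
  have "Re (scaleC_bcontfun d f x) \<le> Re (g x)" for x
    using complex_Re_le_cmod[of "d * f x"] assms[of x] d(1) by (simp add: norm_mult)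
  with d(2) show ?thesis by (simp add: haar_def mean_Re_mono)
qed

lemma haar_const: "haar (const_bcontfun c) = c"
proof -
  have "scaleC_bcontfun \<i> (const_bcontfun c :: 'g \<Rightarrow>\<^sub>C complex) = const_bcontfun (\<i> * c)"
    by (rule bcontfun_eqI) (simp add: const_bcontfun.rep_eq)
  then have "mean_Re (scaleC_bcontfun \<i> (const_bcontfun c :: 'g \<Rightarrow>\<^sub>C complex)) = - Im c"
    by (simp only: mean_Re_const) simp
  then show ?thesis by (simp add: haar_def mean_Re_const complex_eq_iff)
qed

lemma haar_dual: "haar \<in> dual_space UNIV"
proof (rule dual_spaceI[OF haar_linear(1,2)])
  fix f :: "'g \<Rightarrow>\<^sub>C complex"
  have "cmod (haar f) \<le> Re (haar (const_bcontfun (of_real (norm f))))"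
    by (rule haar_bound) (simp add: const_bcontfun.rep_eq norm_bounded)
  then show "cmod (haar f) \<le> 1 * norm f" by (simp add: haar_const)
qed

lemma haar_right_translate: "haar (right_translate h f) = haar f"
proof -
  have "scaleC_bcontfun \<i> (right_translate h f) = right_translate h (scaleC_bcontfun \<i> f)"
    by (rule bcontfun_eqI) simp
  then show ?thesis by (simp add: haar_def mean_Re_right_translate)
qed

lemma haar_cnj: "haar (cnj_bcontfun f) = cnj (haar f)"
proof -
  have eq: "mean_Re u = mean_Re v" if "\<And>x. Re (u x) = Re (v x)" for u v :: "'g \<Rightarrow>\<^sub>C complex"
    by (intro antisym mean_Re_mono) (simp_all add: that)
  have "mean_Re (scaleC_bcontfun \<i> (cnj_bcontfun f)) = mean_Re ((- 1) *\<^sub>R scaleC_bcontfun \<i> f)"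
    by (rule eq) simp
  moreover have "mean_Re (cnj_bcontfun f) = mean_Re f" by (rule eq) simp
  ultimately show ?thesis by (simp add: haar_def complex_eq_iff mean_Re_scaleR[of "-1", simplified])
qed

text \<open>Finitely many translates of \<open>k\<close> have a sum that is bounded below.\<close>

lemma haar_pos:
  fixes k :: "'g \<Rightarrow>\<^sub>C complex"
  assumes "\<And>x. k x = of_real (cmod (k x))" "k 0 \<noteq> 0"
  shows "Re (haar k) > 0"
proof -
  define c where "c = cmod (k 0) / 2"
  have "c > 0" "c < cmod (k 0)" using assms(2) by (auto simp: c_def)
  define V where "V h = {x. c < cmod (k (x + h))}" for h
  have "open (V h)" for h
    unfolding V_def
    by (intro open_Collect_less continuous_intros
        continuous_on_compose2[OF continuous_on_apply_bcontfun[of UNIV k]]) auto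
  moreover have "x \<in> V (- x)" for x using \<open>c < _\<close> by (simp add: V_def)
  then have "UNIV \<subseteq> (\<Union>h. V h)" by auto
  ultimately obtain I where I: "finite I" "UNIV \<subseteq> (\<Union>h\<in>I. V h)"
    using compactE_image[OF compact_group, of UNIV V] by (metis UNIV_I subset_UNIV)
  have Rek: "Re (k x) = cmod (k x)" for x by (metis Re_complex_of_real assms(1))
  have "cmod (haar (const_bcontfun (of_real c))) \<le> Re (haar (\<Sum>h\<in>I. right_translate h k))"
  proof (rule haar_bound)
    fix x
    obtain h where "h \<in> I" "x \<in> V h" using I by auto
    then have "c \<le> Re (k (x + h))" by (simp add: V_def Rek)
    also have "\<dots> \<le> (\<Sum>h\<in>I. Re (k (x + h)))"
      by (rule member_le_sum) (auto simp: I \<open>h \<in> I\<close> Rek)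
    finally show "cmod (const_bcontfun (complex_of_real c) x)
        \<le> Re ((\<Sum>h\<in>I. right_translate h k) x)"
      using \<open>c > 0\<close> by (simp add: const_bcontfun.rep_eq)
  qed
  then have "0 < real (card I) * Re (haar k)"
    using \<open>c > 0\<close> by (simp add: haar_const dual_sum[OF haar_dual] haar_right_translate)
  then show ?thesis by (simp add: zero_less_mult_iff)
qed

end

section \<open>Invariant algebras are sub-bialgebras\<close>

text \<open>The slices of \<open>tensor_fun u v\<close> are multiples of \<open>v\<close> and
  \<open>u\<close>, so the claim holds on the linear span; it passes to the closure because slicing
  does not increase the norm and \<open>A\<close> is closed.\<close>

lemma slices_tensor_hat:
  fixes A :: "('x::topological_space \<Rightarrow>\<^sub>C complex) set"
  assumes A: "closed A" "cfun.subspace A" and F: "F \<in> tensor_hat A"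
  shows "slice_fst F x \<in> A" and "slice_snd F x \<in> A"
proof -
  define S where "S = {F. slice_fst F x \<in> A \<and> slice_snd F x \<in> A}"
  have eqs: "slice_fst (tensor_fun u v) x = scaleC_bcontfun (u x) v"
    "slice_snd (tensor_fun u v) x = scaleC_bcontfun (v x) u"
    "slice_fst 0 x = 0" "slice_snd 0 x = 0"
    "slice_fst (G + H) x = slice_fst G x + slice_fst H x"
    "slice_snd (G + H) x = slice_snd G x + slice_snd H x"
    "slice_fst (scaleC_bcontfun c G) x = scaleC_bcontfun c (slice_fst G x)"
    "slice_snd (scaleC_bcontfun c G) x = scaleC_bcontfun c (slice_snd G x)"
    for u v :: "'x \<Rightarrow>\<^sub>C complex" and G H :: "('x \<times> 'x) \<Rightarrow>\<^sub>C complex" and c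
    by (auto intro!: bcontfun_eqI simp: mult.commute)
  have "cfun.subspace S"
    using A(2) by (auto simp: cfun.subspace_def S_def eqs)
  then have span: "cfun.span {tensor_fun u v | u v. u \<in> A \<and> v \<in> A} \<subseteq> S"
    using A(2) by (intro cfun.span_minimal) (auto simp: S_def eqs cfun.subspace_scale)
  have "\<exists>G\<in>S. norm (G - F) \<le> e" if "e > 0" for e
    using F that span unfolding tensor_hat_def closure_approachable dist_norm
    by (meson less_imp_le subsetD)
  moreover have "norm (slice_fst G x - slice_fst F x) \<le> norm (G - F)"
    "norm (slice_snd G x - slice_snd F x) \<le> norm (G - F)" for G
    using norm_bounded[of "G - F"] by (auto intro!: norm_bound)
  ultimately show "slice_fst F x \<in> A" "slice_snd F x \<in> A"
    by (auto intro!: closed_mem_of_approx[OF A(1)] simp: S_def) (meson order_trans)+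
qed

lemma sub_bialgebra_imp_invariant_algebra:
  assumes "sub_bialgebra A"
  shows "invariant_algebra A"
proof -
  have A: "closed A" "cfun.subspace A" "const_bcontfun 1 \<in> A"
    and mult: "cfun.span {times_bcontfun f g | f g. f \<in> A \<and> g \<in> A} \<subseteq> A"
    and comult: "\<And>f. f \<in> A \<Longrightarrow> comult f \<in> tensor_hat A"
    using assms by (auto simp: sub_bialgebra_def)
  have "const_bcontfun c = scaleC_bcontfun c (const_bcontfun 1)" for c
    by (rule bcontfun_eqI) (simp add: const_bcontfun.rep_eq)
  then have "const_bcontfun c \<in> A" for c
    using cfun.subspace_scale[OF A(2,3)] by metis
  moreover have "times_bcontfun f g \<in> A" if "f \<in> A" "g \<in> A" for f g
    using that by (intro subsetD[OF mult] cfun.span_base) blast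
  moreover have "left_translate g f \<in> A" "right_translate g f \<in> A" if "f \<in> A" for f g
    using slices_tensor_hat[OF A(1,2) comult[OF that], of g] by simp_all
  ultimately show ?thesis using A by (auto simp: invariant_algebra_def)
qed

section \<open>The L2 form of the Haar integral and finite-rank approximation of the
  comultiplication\<close>

context
  assumes compact_group: "compact (UNIV :: 'g::topological_group_add set)"
begin

definition inner_haar :: "('g \<Rightarrow>\<^sub>C complex) \<Rightarrow> ('g \<Rightarrow>\<^sub>C complex) \<Rightarrow> complex" where
  "inner_haar u v = haar (times_bcontfun u (cnj_bcontfun v))"

definition sqnorm_haar :: "('g \<Rightarrow>\<^sub>C complex) \<Rightarrow> real" where
  "sqnorm_haar u = Re (inner_haar u u)"

lemma inner_haar_add: "inner_haar (u + w) v = inner_haar u v + inner_haar w v"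
proof -
  have "times_bcontfun (u + w) (cnj_bcontfun v)
      = times_bcontfun u (cnj_bcontfun v) + times_bcontfun w (cnj_bcontfun v)"
    by (rule bcontfun_eqI) (simp add: algebra_simps)
  then show ?thesis by (simp add: inner_haar_def dual_add[OF haar_dual[OF compact_group]])
qed

lemma inner_haar_scale: "inner_haar (scaleC_bcontfun c u) v = c * inner_haar u v"
proof -
  have "times_bcontfun (scaleC_bcontfun c u) (cnj_bcontfun v)
      = scaleC_bcontfun c (times_bcontfun u (cnj_bcontfun v))"
    by (rule bcontfun_eqI) (simp add: algebra_simps)
  then show ?thesis by (simp add: inner_haar_def dual_scale[OF haar_dual[OF compact_group]])
qed

lemma inner_haar_dual: "(\<lambda>u. inner_haar u v) \<in> dual_space UNIV"
proof (rule dual_spaceI[OF inner_haar_add inner_haar_scale])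
  fix u
  have "cmod (inner_haar u v) \<le> Re (haar (const_bcontfun (of_real (norm v * norm u)) :: 'g \<Rightarrow>\<^sub>C complex))"
    unfolding inner_haar_def
    by (rule haar_bound[OF compact_group])
      (simp add: const_bcontfun.rep_eq norm_mult mult.commute mult_mono norm_bounded)
  then show "cmod (inner_haar u v) \<le> norm v * norm u" by (simp add: haar_const[OF compact_group])
qed

lemma inner_haar_diff: "inner_haar (u - w) v = inner_haar u v - inner_haar w v"
  by (rule dual_diff[OF inner_haar_dual])

lemma inner_haar_sum: "inner_haar (\<Sum>i\<in>I. f i) v = (\<Sum>i\<in>I. inner_haar (f i) v)"
  by (rule dual_sum[OF inner_haar_dual])

lemma inner_haar_cnj: "inner_haar v u = cnj (inner_haar u v)"
proof -
  have "times_bcontfun v (cnj_bcontfun u) = cnj_bcontfun (times_bcontfun u (cnj_bcontfun v))"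
    by (rule bcontfun_eqI) simp
  then show ?thesis by (simp add: inner_haar_def haar_cnj[OF compact_group])
qed

lemma inner_haar_scale_right: "inner_haar u (scaleC_bcontfun c v) = cnj c * inner_haar u v"
  by (metis complex_cnj_mult inner_haar_cnj inner_haar_scale)

lemma inner_haar_diff_right: "inner_haar u (v - w) = inner_haar u v - inner_haar u w"
  by (metis complex_cnj_diff inner_haar_cnj inner_haar_diff)

text \<open>With the integrand as its own majorant, \<open>haar_bound\<close> gives a number whose
  modulus is at most its real part; such a number is real and nonnegative.\<close>

lemma inner_haar_self: "inner_haar u u = of_real (sqnorm_haar u)" and sqnorm_haar_nonneg: "sqnorm_haar u \<ge> 0"
proof -
  have "cmod (inner_haar u u) \<le> Re (inner_haar u u)"
    unfolding inner_haar_def by (rule haar_bound[OF compact_group]) (simp add: complex_norm_square[symmetric] norm_power)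
  then show "inner_haar u u = of_real (sqnorm_haar u)" "sqnorm_haar u \<ge> 0"
    using complex_eq_cancel_iff2 abs_Re_le_cmod[of "inner_haar u u"] cmod_eq_Re[of "inner_haar u u"]
      cmod_power2[of "inner_haar u u"] norm_ge_zero[of "inner_haar u u"]
    by (auto simp: sqnorm_haar_def complex_eq_iff intro: order_trans[OF norm_ge_zero])
qed

lemma sqnorm_haar_le: "sqnorm_haar u \<le> (norm u)\<^sup>2"
proof -
  have "cmod (inner_haar u u) \<le> Re (haar (const_bcontfun (of_real ((norm u)\<^sup>2)) :: 'g \<Rightarrow>\<^sub>C complex))"
    unfolding inner_haar_def
    by (rule haar_bound[OF compact_group])
      (simp add: const_bcontfun.rep_eq complex_norm_square[symmetric] norm_bounded power_mono norm_power)
  then show ?thesis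
    using complex_Re_le_cmod[of "inner_haar u u"] by (simp add: sqnorm_haar_def haar_const[OF compact_group])
qed

lemma sqnorm_haar_right_translate: "sqnorm_haar (right_translate h u) = sqnorm_haar u"
proof -
  have "times_bcontfun (right_translate h u) (cnj_bcontfun (right_translate h u))
      = right_translate h (times_bcontfun u (cnj_bcontfun u))"
    by (rule bcontfun_eqI) simp
  then show ?thesis by (simp add: sqnorm_haar_def inner_haar_def haar_right_translate[OF compact_group])
qed

text \<open>Pythagoras along a unit vector. Nonnegativity of the left side is Bessel's inequality,
  hence Cauchy-Schwarz; the decrease on the right is what keeps the residual in Gram-Schmidt from
  growing.\<close>

lemma sqnorm_haar_project:
  assumes "sqnorm_haar e = 1"
  shows "sqnorm_haar (v - scaleC_bcontfun (inner_haar v e) e) = sqnorm_haar v - (cmod (inner_haar v e))\<^sup>2"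
proof -
  define c where "c = inner_haar v e"
  have "inner_haar (v - scaleC_bcontfun c e) (v - scaleC_bcontfun c e) = inner_haar v v - c * cnj c"
    using assms inner_haar_cnj[of e v]
    by (simp add: inner_haar_diff inner_haar_diff_right inner_haar_scale inner_haar_scale_right
        inner_haar_self[of e] algebra_simps flip: c_def)
  then have "sqnorm_haar (v - scaleC_bcontfun c e) = sqnorm_haar v - (cmod c)\<^sup>2"
    by (simp add: sqnorm_haar_def complex_norm_square[symmetric] del: of_real_power flip: of_real_power)
  then show ?thesis by (simp add: c_def)
qed

lemma sqnorm_haar_normalize:
  assumes "sqnorm_haar k > 0"
  shows "sqnorm_haar (scaleC_bcontfun (of_real (1 / sqrt (sqnorm_haar k))) k) = 1"
proof -
  have "complex_of_real (sqrt (sqnorm_haar k)) * of_real (sqrt (sqnorm_haar k)) = of_real (sqnorm_haar k)"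
    using assms by (simp flip: of_real_mult)
  then show ?thesis
    using assms by (simp add: sqnorm_haar_def[of "scaleC_bcontfun _ _"] inner_haar_scale
        inner_haar_scale_right inner_haar_self[of k])
qed

lemma Cauchy_Schwarz_haar:
  assumes "sqnorm_haar k > 0"
  shows "cmod (inner_haar v k) \<le> sqrt (sqnorm_haar k) * sqrt (sqnorm_haar v)"
proof -
  define e where "e = scaleC_bcontfun (of_real (1 / sqrt (sqnorm_haar k))) k"
  have "sqnorm_haar e = 1" unfolding e_def by (rule sqnorm_haar_normalize[OF assms])
  from sqnorm_haar_project[OF this, of v] sqnorm_haar_nonneg
  have "(cmod (inner_haar v e))\<^sup>2 \<le> sqnorm_haar v" by (metis diff_ge_0_iff_ge)
  then have "cmod (inner_haar v e) \<le> sqrt (sqnorm_haar v)" by (rule real_le_rsqrt)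
  moreover have "cmod (inner_haar v e) = cmod (inner_haar v k) / sqrt (sqnorm_haar k)"
    using assms by (simp add: e_def inner_haar_scale_right norm_mult norm_divide)
  ultimately show ?thesis using assms by (simp add: field_simps)
qed

definition project_haar :: "('g \<Rightarrow>\<^sub>C complex) set \<Rightarrow> ('g \<Rightarrow>\<^sub>C complex) \<Rightarrow> ('g \<Rightarrow>\<^sub>C complex)" where
  "project_haar E u = (\<Sum>e\<in>E. scaleC_bcontfun (inner_haar u e) e)"

text \<open>
  Gram-Schmidt for a semi-definite form: \<open>b - P b\<close> need not vanish, but it is a null vector.
\<close>

lemma Gram_Schmidt_haar:
  fixes A :: "('g \<Rightarrow>\<^sub>C complex) set"
  assumes A: "cfun.subspace A" and "finite B" "B \<subseteq> A"
  shows "\<exists>E. finite E \<and> E \<subseteq> A \<and>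
    (\<forall>u. \<forall>e\<in>E. inner_haar (u - project_haar E u) e = 0) \<and>
    (\<forall>u. sqnorm_haar (u - project_haar E u) \<le> sqnorm_haar u) \<and>
    (\<forall>b\<in>B. sqnorm_haar (b - project_haar E b) = 0)"
  using assms(2,3)
proof (induction B)
  case empty
  then show ?case by (intro exI[of _ "{}"]) (auto simp: project_haar_def)
next
  case (insert b B)
  then obtain E where E: "finite E" "E \<subseteq> A"
    and P': "\<forall>u. \<forall>e\<in>E. inner_haar (u - project_haar E u) e = 0"
      "\<forall>u. sqnorm_haar (u - project_haar E u) \<le> sqnorm_haar u"
      "\<forall>b\<in>B. sqnorm_haar (b - project_haar E b) = 0"
    by blast
  define P where "P = project_haar E"
  note P' = P'[folded P_def, rule_format]
  have PA: "P u \<in> A" for u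
    unfolding P_def project_haar_def using E(2)
    by (intro cfun.subspace_sum cfun.subspace_scale A) auto
  define w where "w = b - P b"
  have wA: "w \<in> A"
    using insert.prems PA unfolding w_def by (intro cfun.subspace_diff A) auto
  show ?case
  proof (cases "sqnorm_haar w = 0")
    case True
    then show ?thesis
      using E P' by (intro exI[of _ E]) (auto simp: w_def P_def)
  next
    case False
    then have pos: "sqnorm_haar w > 0" using sqnorm_haar_nonneg[of w] by simp
    define e' where "e' = scaleC_bcontfun (of_real (1 / sqrt (sqnorm_haar w))) w"
    have e'1: "sqnorm_haar e' = 1" unfolding e'_def by (rule sqnorm_haar_normalize[OF pos])
    \<comment> \<open>Orthonormality of \<open>E\<close> is not carried through the induction; the
      invariant that residuals \<open>u - P u\<close> are orthogonal to \<open>E\<close> suffices,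
      since \<open>w\<close> is such a residual.\<close>
    have orth: "inner_haar e' e = 0" "inner_haar e e' = 0" if "e \<in> E" for e
      using P'(1)[OF that, of b] inner_haar_cnj[of e w]
      by (simp_all add: e'_def inner_haar_scale inner_haar_scale_right w_def)
    have "e' \<notin> E" using orth(1)[of e'] e'1 by (auto simp: inner_haar_self)
    have e'A: "e' \<in> A" unfolding e'_def by (intro cfun.subspace_scale A wA)
    have Pe': "inner_haar (P u) e' = 0" for u
      by (simp add: P_def project_haar_def inner_haar_sum inner_haar_scale orth)
    \<comment> \<open>As \<open>P u\<close> is orthogonal to \<open>e'\<close>, the new coefficient
      of \<open>u\<close> is that of \<open>u - P u\<close>: the new residual is the old one with
      its component along \<open>e'\<close> removed.\<close>
    have step: "u - project_haar (insert e' E) u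
        = (u - P u) - scaleC_bcontfun (inner_haar (u - P u) e') e'" for u
      using E(1) \<open>e' \<notin> E\<close> by (simp add: P_def project_haar_def inner_haar_diff Pe'[unfolded P_def project_haar_def])
    have less: "sqnorm_haar ((u - P u) - scaleC_bcontfun (inner_haar (u - P u) e') e')
        \<le> sqnorm_haar (u - P u)" for u
      unfolding sqnorm_haar_project[OF e'1] by simp
    have "inner_haar w e' = of_real (1 / sqrt (sqnorm_haar w) * sqnorm_haar w)"
      by (simp add: e'_def inner_haar_scale_right inner_haar_self)
    also have "1 / sqrt (sqnorm_haar w) * sqnorm_haar w = sqrt (sqnorm_haar w)"
      using pos by (simp add: real_div_sqrt)
    finally have "inner_haar w e' = of_real (sqrt (sqnorm_haar w))" .
    then have "w - scaleC_bcontfun (inner_haar w e') e' = 0"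
      using pos by (simp add: e'_def)
    then have b0: "sqnorm_haar ((b - P b) - scaleC_bcontfun (inner_haar (b - P b) e') e') = 0"
      unfolding w_def[symmetric] by (simp add: sqnorm_haar_def dual_zero[OF inner_haar_dual])
    have B0: "sqnorm_haar ((c - P c) - scaleC_bcontfun (inner_haar (c - P c) e') e') = 0" if "c \<in> B" for c
      using less[of c] P'(3)[OF that] sqnorm_haar_nonneg by (metis antisym)
    show ?thesis
    proof (intro exI[of _ "insert e' E"] conjI allI, unfold step)
      fix u
      show "\<forall>e\<in>insert e' E. inner_haar (u - P u - scaleC_bcontfun (inner_haar (u - P u) e') e') e = 0"
        using P'(1) orth e'1 by (auto simp: inner_haar_diff[of "u - P u"] inner_haar_scale inner_haar_self[of e'])
      show "sqnorm_haar (u - P u - scaleC_bcontfun (inner_haar (u - P u) e') e') \<le> sqnorm_haar u"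
        using less[of u] P'(2)[of u] by linarith
    qed (use E e'A b0 B0 in auto)
  qed
qed

text \<open>
  The approximate identity \<open>\<nu> = k dm / \<integral> k dm\<close> is built from \<open>f\<close> itself, so no Urysohn function is
  needed, and \<open>T u (y) = \<nu> (right_translate y u)\<close> maps \<open>A\<close> to \<open>A\<close> and is bounded from the
  seminorm of \<open>L\<^sup>2\<close> to the sup-norm. Composing \<open>T\<close> with the orthogonal projection onto the span of a
  finite net of the compact set of right translates of \<open>f\<close> gives a finite-rank approximation of
  \<open>comult f\<close> with both legs in \<open>A\<close>.
\<close>

lemma comult_in_tensor_hat:
  fixes A :: "('g \<Rightarrow>\<^sub>C complex) set"
  assumes A: "closed A" "cfun.subspace A"
    and L: "\<And>g u. u \<in> A \<Longrightarrow> left_translate g u \<in> A" and R: "\<And>g u. u \<in> A \<Longrightarrow> right_translate g u \<in> A"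
    and f: "f \<in> A"
  shows "comult f \<in> tensor_hat A"
  unfolding tensor_hat_def closure_approachable
proof (intro allI impI)
  fix \<epsilon> :: real assume "\<epsilon> > 0"
  \<comment> \<open>Smoothing and projecting cost \<open>d\<close> each; the remaining third yields
    the strict inequality.\<close>
  define d where "d = \<epsilon> / 3"
  have d: "d > 0" using \<open>\<epsilon> > 0\<close> by (simp add: d_def)
  have cL: "continuous_on UNIV (\<lambda>x. left_translate x f)"
    using continuous_slice_fst[OF compact_group, of "comult f"] by simp
  have cR: "continuous_on UNIV (\<lambda>x. right_translate x f)"
    using continuous_slice_snd[OF compact_group, of "comult f"] by simp
  \<comment> \<open>Positive only where left translation by \<open>x\<close> moves \<open>f\<close>
    by less than \<open>d\<close> in the sup-norm. On that set \<open>f (x + z)\<close> is within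
    \<open>d\<close> of \<open>f z\<close> for all \<open>z\<close> at once, so the
    \<open>\<kappa>\<close>-weighted mean of \<open>f (x + z)\<close> over \<open>x\<close> stays
    within \<open>d\<close> of \<open>f z\<close>.\<close>
  define \<kappa> where "\<kappa> x = max 0 (d - dist (left_translate x f) f)" for x
  define k where "k = Bcontfun (\<lambda>x. complex_of_real (\<kappa> x))"
  have k: "k x = of_real (\<kappa> x)" for x
  proof -
    have "(\<lambda>x. complex_of_real (\<kappa> x)) \<in> bcontfun"
      unfolding \<kappa>_def
      by (intro compact_UNIV_bcontfunI compact_group continuous_intros cL)
    then show ?thesis by (simp add: k_def Bcontfun_inverse)
  qed
  have \<kappa>0: "\<kappa> x \<ge> 0" for x by (simp add: \<kappa>_def)
  have "left_translate 0 f = f" by (rule bcontfun_eqI) simp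
  then have k00: "k 0 \<noteq> 0" using d by (simp add: k \<kappa>_def)
  have m: "Re (haar k) > 0"
    by (rule haar_pos[OF compact_group _ k00]) (simp add: k \<kappa>0)
  have mk: "haar k = of_real (Re (haar k))"
  proof -
    have "cnj_bcontfun k = k" by (rule bcontfun_eqI) (simp add: k)
    then show ?thesis using haar_cnj[OF compact_group, of k] by (simp add: complex_eq_iff)
  qed
  have qk: "sqnorm_haar k > 0"
    unfolding sqnorm_haar_def inner_haar_def
    by (rule haar_pos[OF compact_group]) (use k00 in \<open>auto simp: k \<kappa>0 norm_mult\<close>)
  define \<nu> where "\<nu> u = inner_haar u k / haar k" for u
  have \<nu>: "\<nu> \<in> dual_space UNIV"
  proof -
    obtain K where "\<And>u. cmod (inner_haar u k) \<le> K * norm u"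
      using dual_bound[OF inner_haar_dual[of k]] by blast
    then show ?thesis
      by (intro dual_spaceI[where K = "K / cmod (haar k)"])
        (auto simp: \<nu>_def inner_haar_add inner_haar_scale add_divide_distrib norm_divide
          intro: divide_right_mono)
  qed
  have \<nu>_close: "cmod (\<nu> (right_translate z f) - f z) \<le> d" for z
  proof -
    define u where "u = right_translate z f - const_bcontfun (f z)"
    have "cmod (times_bcontfun u (cnj_bcontfun k) x) \<le> Re (scaleC_bcontfun (of_real d) k x)" for x
    proof (cases "\<kappa> x = 0")
      case True
      then show ?thesis by (simp add: k)
    next
      case False
      then have "dist (left_translate x f) f < d" by (auto simp: \<kappa>_def max_def split: if_splits)
      from dist_fun_lt_imp_dist_val_lt[OF this, of z] have "cmod (u x) \<le> d"
        by (simp add: u_def const_bcontfun.rep_eq dist_norm)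
      then show ?thesis using \<kappa>0[of x] by (simp add: k norm_mult mult_right_mono)
    qed
    from haar_bound[OF compact_group, OF this]
    have "cmod (inner_haar u k) \<le> d * Re (haar k)"
      by (simp add: inner_haar_def dual_scale[OF haar_dual[OF compact_group]])
    moreover have "cmod (haar k) = Re (haar k)" using m by (subst mk) simp
    ultimately have "cmod (\<nu> u) \<le> d" using m by (simp add: \<nu>_def norm_divide field_simps)
    moreover have "times_bcontfun (const_bcontfun c) (cnj_bcontfun k) = scaleC_bcontfun c k" for c
      by (rule bcontfun_eqI) (simp add: const_bcontfun.rep_eq k)
    then have "\<nu> (const_bcontfun (f z)) = f z"
      using m by (auto simp: \<nu>_def inner_haar_def dual_scale[OF haar_dual[OF compact_group]])
    ultimately show ?thesis by (simp add: u_def dual_diff[OF \<nu>])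
  qed
  \<comment> \<open>The norm of \<open>T\<close> from the L2 seminorm to the sup-norm, by
    Cauchy-Schwarz against \<open>k\<close>; right invariance of the seminorm makes it uniform in
    \<open>y\<close>. The mesh \<open>d / C\<close> below turns into an error of
    \<open>d\<close>.\<close>
  define C where "C = sqrt (sqnorm_haar k) / Re (haar k)"
  have C: "C > 0" using qk m by (simp add: C_def)
  have \<nu>_sqnorm: "cmod (\<nu> (right_translate y v)) \<le> C * sqrt (sqnorm_haar v)" for y v
  proof -
    have "cmod (haar k) = Re (haar k)" using m by (subst mk) simp
    then show ?thesis
      using Cauchy_Schwarz_haar[OF qk, of "right_translate y v"] m
      by (simp add: \<nu>_def norm_divide C_def sqnorm_haar_right_translate divide_right_mono)
  qed
  have "d / C > 0" using d C by simp
  from finite_net_of_compact[OF compact_group cR this]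
  obtain H where H: "finite H" "\<And>h. \<exists>j\<in>H. dist (right_translate h f) (right_translate j f) < d / C"
    by metis
  have "(\<lambda>j. right_translate j f) ` H \<subseteq> A" using R[OF f] by auto
  from Gram_Schmidt_haar[OF A(2) _ this] H(1)
  obtain E where E: "finite E" "E \<subseteq> A"
    and E_less: "\<And>u. sqnorm_haar (u - project_haar E u) \<le> sqnorm_haar u"
    and E_null: "\<And>j. j \<in> H \<Longrightarrow>
      sqnorm_haar (right_translate j f - project_haar E (right_translate j f)) = 0"
    by blast
  define P where "P = project_haar E"
  define T where "T u = partial_integral \<nu> (comult u)" for u
  have T: "T u y = \<nu> (right_translate y u)" for u y
    by (simp add: T_def partial_integral_apply[OF compact_group \<nu>])
  have TA: "T u \<in> A" if "u \<in> A" for u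
    unfolding T_def
    by (rule partial_integral_in_subspace[OF compact_group compact_group \<nu> A]) (simp add: L that)
  define \<psi> where "\<psi> e = partial_integral (\<lambda>u. inner_haar u e) (comult f)" for e
  have \<psi>: "\<psi> e h = inner_haar (right_translate h f) e" for e h
    by (simp add: \<psi>_def partial_integral_apply[OF compact_group inner_haar_dual])
  have \<psi>A: "\<psi> e \<in> A" for e
    unfolding \<psi>_def
    by (rule partial_integral_in_subspace[OF compact_group compact_group inner_haar_dual A])
      (simp add: L f)
  \<comment> \<open>As a function of \<open>y\<close>, \<open>comult f (y, h)\<close> is the right
    translate of \<open>f\<close> by \<open>h\<close>; \<open>G\<close> replaces it by
    \<open>T\<close> of its projection. Expanding the projection over \<open>E\<close> separates the
    variables, with \<open>\<psi> e\<close> the coefficient as a function of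
    \<open>h\<close>.\<close>
  define G where "G = (\<Sum>e\<in>E. tensor_fun (T e) (\<psi> e))"
  have "G \<in> cfun.span {tensor_fun u v | u v. u \<in> A \<and> v \<in> A}"
    unfolding G_def using E(2) TA \<psi>A by (intro cfun.span_sum cfun.span_base) blast
  moreover have "dist G (comult f) < \<epsilon>"
  proof -
    have "cmod ((G - comult f) p) \<le> 2 * d" for p
    proof -
      obtain y h where p: "p = (y, h)" by fastforce
      define v where "v = right_translate h f"
      have rt: "right_translate y (a - b) = right_translate y a - right_translate y b"
        "right_translate y (a + b) = right_translate y a + right_translate y b"
        "right_translate y (P u) = (\<Sum>e\<in>E. scaleC_bcontfun (inner_haar u e) (right_translate y e))"
        for a b u :: "'g \<Rightarrow>\<^sub>C complex"
        by (auto intro!: bcontfun_eqI simp: P_def project_haar_def)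
      have G: "G p = \<nu> (right_translate y (P v))"
        by (simp add: p G_def T \<psi> rt v_def dual_sum[OF \<nu>] dual_scale[OF \<nu>] mult.commute)
      have "right_translate y v = right_translate (y + h) f"
        by (rule bcontfun_eqI) (simp add: v_def add.assoc)
      with \<nu>_close[of "y + h"] have 1: "cmod (\<nu> (right_translate y v) - f (y + h)) \<le> d" by simp
      obtain j where j: "j \<in> H" "dist v (right_translate j f) < d / C" using H(2) v_def by metis
      define a where "a = right_translate j f"
      define w where "w = v - a"
      have "P v = P w + P a"
        by (simp add: w_def P_def project_haar_def inner_haar_diff cfun.scale_left_diff_distrib sum_subtractf)
      \<comment> \<open>The net point \<open>a\<close> is reproduced by \<open>P\<close> only up to
        a null vector, but \<open>\<nu>\<close> is bounded by the seminorm and does not see it. The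
        residual of \<open>w\<close> is controlled by the contraction property and the mesh.\<close>
      then have "v - P v = (w - P w) + (a - P a)" by (simp add: w_def)
      then have "\<nu> (right_translate y v) - \<nu> (right_translate y (P v))
          = \<nu> (right_translate y (w - P w)) + \<nu> (right_translate y (a - P a))"
        by (metis dual_add[OF \<nu>] dual_diff[OF \<nu>] rt(1,2))
      also have "\<nu> (right_translate y (a - P a)) = 0"
        using \<nu>_sqnorm[of y "a - P a"] E_null[OF j(1)] by (simp add: a_def P_def)
      finally have "cmod (\<nu> (right_translate y v) - \<nu> (right_translate y (P v)))
          \<le> C * sqrt (sqnorm_haar (w - P w))" using \<nu>_sqnorm[of y "w - P w"] by simp
      also have "sqrt (sqnorm_haar (w - P w)) \<le> sqrt (sqnorm_haar w)"
        using E_less[of w] by (simp add: P_def)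
      also have "sqrt (sqnorm_haar w) \<le> norm w" using sqnorm_haar_le[of w] by (simp add: real_le_lsqrt)
      also have "norm w \<le> d / C" using j(2) by (simp add: w_def a_def dist_norm)
      also have "C * (d / C) = d" using C by simp
      finally have 2: "cmod (\<nu> (right_translate y v) - \<nu> (right_translate y (P v))) \<le> d"
        using C by simp
      have "(G - comult f) p = (\<nu> (right_translate y v) - f (y + h))
          - (\<nu> (right_translate y v) - \<nu> (right_translate y (P v)))"
        by (simp add: G) (simp add: p)
      then show ?thesis using norm_triangle_ineq4 1 2 by (smt (verit))
    qed
    then have "norm (G - comult f) \<le> 2 * d" by (rule norm_bound)
    then show ?thesis using \<open>\<epsilon> > 0\<close> by (simp add: dist_norm d_def)
  qed
  ultimately show "\<exists>F\<in>cfun.span {tensor_fun u v | u v. u \<in> A \<and> v \<in> A}. dist F (comult f) < \<epsilon>"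
    by blast
qed

lemma invariant_algebra_imp_sub_bialgebra:
  fixes A :: "('g \<Rightarrow>\<^sub>C complex) set"
  assumes "invariant_algebra A"
  shows "sub_bialgebra A"
proof -
  have A: "closed A" "cfun.subspace A"
    using assms by (auto simp: invariant_algebra_def)
  have "cfun.span {times_bcontfun f g | f g. f \<in> A \<and> g \<in> A} \<subseteq> A"
    using assms by (intro cfun.span_minimal[OF _ A(2)]) (auto simp: invariant_algebra_def)
  moreover have "comult f \<in> tensor_hat A" if "f \<in> A" for f
    using assms that by (intro comult_in_tensor_hat A) (auto simp: invariant_algebra_def)
  ultimately show ?thesis
    using assms A by (auto simp: sub_bialgebra_def invariant_algebra_def)
qed

end

section \<open>The Hahn-Banach theorem\<close>

text \<open>
  Zorn's lemma is applied to graphs: a real subspace \<open>H\<close> of \<open>'a \<times> real\<close> with \<open>a \<le> K * norm x\<close> for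
  all \<open>(x, a) \<in> H\<close> is automatically the graph of a linear functional.
\<close>

lemma dominated_graph_extend:
  fixes M :: "('a::real_normed_vector \<times> real) set"
  assumes M: "subspace M" and dom: "\<And>x a. (x, a) \<in> M \<Longrightarrow> a \<le> K * norm x" and "K \<ge> 0"
  obtains c M' where "subspace M'" "M \<subseteq> M'" "(x0, c) \<in> M'"
    "\<And>x a. (x, a) \<in> M' \<Longrightarrow> a \<le> K * norm x"
proof -
  define S where "S = {a - K * norm (x - x0) | x a. (x, a) \<in> M}"
  have M0: "(0, 0) \<in> M" using subspace_0[OF M] by (simp add: zero_prod_def)
  \<comment> \<open>An admissible value at \<open>x0\<close> must lie above all left sides (for
    negative multiples of \<open>x0\<close>) and below all right sides (for positive ones). This
    inequality shows that such a value exists; \<open>Sup S\<close> is the least.\<close>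
  have le: "a - K * norm (x - x0) \<le> K * norm (y + x0) - b" if "(x, a) \<in> M" "(y, b) \<in> M" for x y a b
  proof -
    have "(x + y, a + b) \<in> M" using subspace_add[OF M that] by simp
    then have "a + b \<le> K * norm ((x - x0) + (y + x0))" using dom by simp
    also have "\<dots> \<le> K * (norm (x - x0) + norm (y + x0))"
      by (intro mult_left_mono norm_triangle_ineq \<open>K \<ge> 0\<close>)
    finally show ?thesis by (simp add: algebra_simps)
  qed
  define c where "c = Sup S"
  have c_ge: "a - K * norm (x - x0) \<le> c" if "(x, a) \<in> M" for x a
    unfolding c_def
    by (rule cSup_upper) (use that le[OF _ M0] in \<open>auto simp: S_def intro!: bdd_aboveI\<close>)
  have c_le: "c \<le> K * norm (y + x0) - b" if "(y, b) \<in> M" for y b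
    unfolding c_def by (rule cSup_least) (use that le M0 in \<open>auto simp: S_def\<close>)
  define M' where "M' = {p + q | p q. p \<in> M \<and> q \<in> span {(x0, c)}}"
  have "subspace M'" unfolding M'_def by (intro subspace_sums M subspace_span)
  moreover have "p \<in> M'" if "p \<in> M" for p
    unfolding M'_def using that span_zero[of "{(x0, c)}"] add_0_right[of p, symmetric] by blast
  then have "M \<subseteq> M'" by blast
  moreover have "(x0, c) \<in> M'"
    unfolding M'_def
    using subspace_0[OF M] span_base[of "(x0, c)" "{(x0, c)}"] add_0_left[of "(x0, c)", symmetric]
    by blast
  moreover have "z \<le> K * norm y" if yz: "(y, z) \<in> M'" for y z
  proof -
    obtain x a t where xa: "(x, a) \<in> M" and y: "y = x + t *\<^sub>R x0" and z: "z = a + t * c"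
      using yz unfolding M'_def span_singleton by auto
    have scaled: "(r *\<^sub>R x, r * a) \<in> M" for r
      using subspace_scale[OF M xa, of r] by simp
    consider "t = 0" | "t > 0" | "t < 0" by linarith
    then show ?thesis
    proof cases
      case 1
      then show ?thesis using dom[OF xa] y z by simp
    next
      case 2
      have "t * (c + inverse t * a) \<le> t * (K * norm (inverse t *\<^sub>R x + x0))"
        using c_le[OF scaled, of "inverse t"] 2 by (intro mult_left_mono) auto
      moreover have "t * norm (inverse t *\<^sub>R x + x0) = norm (t *\<^sub>R (inverse t *\<^sub>R x + x0))"
        using 2 by simp
      ultimately show ?thesis
        using 2 by (simp add: y z algebra_simps)
    next
      case 3
      define s where "s = - t"
      have s: "s > 0" using 3 by (simp add: s_def)
      have "s * (inverse s * a - c) \<le> s * (K * norm (inverse s *\<^sub>R x - x0))"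
        using c_ge[OF scaled, of "inverse s"] s by (intro mult_left_mono) auto
      moreover have "s * norm (inverse s *\<^sub>R x - x0) = norm (s *\<^sub>R (inverse s *\<^sub>R x - x0))"
        using s by simp
      ultimately have "a - s * c \<le> K * norm (x - s *\<^sub>R x0)"
        using s by (simp add: algebra_simps)
      then show ?thesis by (simp add: y z s_def)
    qed
  qed
  ultimately show thesis by (rule that)
qed

lemma Hahn_Banach_real:
  fixes \<phi> :: "'a::real_normed_vector \<Rightarrow> real"
  assumes A: "subspace A" and "K \<ge> 0"
    and add: "\<And>x y. x \<in> A \<Longrightarrow> y \<in> A \<Longrightarrow> \<phi> (x + y) = \<phi> x + \<phi> y"
    and scale: "\<And>r x. x \<in> A \<Longrightarrow> \<phi> (r *\<^sub>R x) = r * \<phi> x"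
    and bound: "\<And>x. x \<in> A \<Longrightarrow> \<phi> x \<le> K * norm x"
  shows "\<exists>U. (\<forall>x y. U (x + y) = U x + U y) \<and> (\<forall>r x. U (r *\<^sub>R x) = r * U x) \<and>
    (\<forall>x. U x \<le> K * norm x) \<and> (\<forall>x\<in>A. U x = \<phi> x)"
proof -
  define \<G> where "\<G> = {H. subspace H \<and> (\<forall>x a. (x, a) \<in> H \<longrightarrow> a \<le> K * norm x) \<and> (\<lambda>x. (x, \<phi> x)) ` A \<subseteq> H}"
  have "\<phi> 0 = 0" using scale[of 0 0] subspace_0[OF A] by simp
  then have "subspace ((\<lambda>x. (x, \<phi> x)) ` A)"
    using A unfolding subspace_def
    by (auto simp: zero_prod_def image_iff add scale)
  then have "(\<lambda>x. (x, \<phi> x)) ` A \<in> \<G>"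
    using bound by (auto simp: \<G>_def)
  then have ne: "\<G> \<noteq> {}" by auto
  have chain: "\<Union>\<C> \<in> \<G>" if "\<C> \<noteq> {}" "subset.chain \<G> \<C>" for \<C>
  proof -
    have sub: "\<C> \<subseteq> \<G>" and tot: "\<And>X Y. X \<in> \<C> \<Longrightarrow> Y \<in> \<C> \<Longrightarrow> X \<subseteq> Y \<or> Y \<subseteq> X"
      using that(2) by (auto simp: subset.chain_def)
    have ss: "subspace X" if "X \<in> \<C>" for X using that sub by (auto simp: \<G>_def)
    have "subspace (\<Union>\<C>)"
    proof (rule subspaceI)
      show "0 \<in> \<Union>\<C>" using that(1) ss subspace_0 by blast
      show "p + q \<in> \<Union>\<C>" if pq: "p \<in> \<Union>\<C>" "q \<in> \<Union>\<C>" for p q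
      proof -
        obtain X Y where XY: "X \<in> \<C>" "Y \<in> \<C>" "p \<in> X" "q \<in> Y" using pq by blast
        with tot[OF XY(1,2)] obtain Z where "Z \<in> \<C>" "p \<in> Z" "q \<in> Z" by blast
        with ss[of Z] show ?thesis using subspace_add by blast
      qed
      show "r *\<^sub>R p \<in> \<Union>\<C>" if "p \<in> \<Union>\<C>" for p r
        using that ss subspace_scale by blast
    qed
    moreover have "a \<le> K * norm x" if "(x, a) \<in> \<Union>\<C>" for x a
      using that sub by (auto simp: \<G>_def)
    moreover have "(\<lambda>x. (x, \<phi> x)) ` A \<subseteq> \<Union>\<C>"
      using that(1) sub unfolding \<G>_def by blast
    ultimately show ?thesis by (simp add: \<G>_def)
  qed
  obtain M where "M \<in> \<G>" and max: "\<And>X. X \<in> \<G> \<Longrightarrow> M \<subseteq> X \<Longrightarrow> X = M"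
    using subset_Zorn_nonempty[OF ne chain] by blast
  then have M: "subspace M" and dom: "\<And>x a. (x, a) \<in> M \<Longrightarrow> a \<le> K * norm x"
    and \<phi>M: "\<And>x. x \<in> A \<Longrightarrow> (x, \<phi> x) \<in> M" by (auto simp: \<G>_def)
  have total: "\<exists>a. (x, a) \<in> M" for x
  proof -
    obtain c M' where M': "subspace M'" "M \<subseteq> M'" "(x, c) \<in> M'"
      "\<And>x a. (x, a) \<in> M' \<Longrightarrow> a \<le> K * norm x"
      using dominated_graph_extend[OF M dom \<open>K \<ge> 0\<close>, of x] by metis
    have "M' \<in> \<G>" using M' \<phi>M by (auto simp: \<G>_def)
    then show ?thesis using max[OF _ M'(2)] M'(3) by blast
  qed
  \<comment> \<open>Domination at the point 0 bounds both differences of the two values by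
    0.\<close>
  have unique: "a = b" if "(x, a) \<in> M" "(x, b) \<in> M" for x a b
  proof -
    have "(0, a - b) \<in> M" "(0, b - a) \<in> M"
      using subspace_diff[OF M that] subspace_diff[OF M that(2,1)] by simp_all
    from this[THEN dom] show ?thesis by simp
  qed
  define U where "U x = (THE a. (x, a) \<in> M)" for x
  have UM: "(x, U x) \<in> M" for x
    unfolding U_def using total[of x] unique by (metis theI)
  have U: "U x = a" if "(x, a) \<in> M" for x a using UM that unique by blast
  show ?thesis
  proof (intro exI[of _ U] conjI allI ballI)
    show "U (x + y) = U x + U y" for x y using subspace_add[OF M UM[of x] UM[of y]] by (intro U) simp
    show "U (r *\<^sub>R x) = r * U x" for r x using subspace_scale[OF M UM[of x], of r] by (intro U) simp
    show "U x \<le> K * norm x" for x by (rule dom[OF UM])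
    show "U x = \<phi> x" if "x \<in> A" for x by (rule U[OF \<phi>M[OF that]])
  qed
qed

text \<open>The real part is extended and then complexified. The bound keeps the same
  \<open>K\<close>, and this exactness later makes the quotient map an isometry.\<close>

lemma Hahn_Banach_bcontfun:
  fixes A :: "('x::topological_space \<Rightarrow>\<^sub>C complex) set"
  assumes A: "cfun.subspace A" and \<phi>: "\<phi> \<in> dual_space A" and "K \<ge> 0"
    and bound: "\<And>f. f \<in> A \<Longrightarrow> cmod (\<phi> f) \<le> K * norm f"
  obtains \<psi> where "\<psi> \<in> dual_space UNIV" "\<And>f. cmod (\<psi> f) \<le> K * norm f" "\<And>f. f \<in> A \<Longrightarrow> \<psi> f = \<phi> f"
proof -
  have add: "\<And>f g. f \<in> A \<Longrightarrow> g \<in> A \<Longrightarrow> \<phi> (f + g) = \<phi> f + \<phi> g"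
    and scale: "\<And>c f. f \<in> A \<Longrightarrow> \<phi> (scaleC_bcontfun c f) = c * \<phi> f"
    using \<phi> by (auto simp: dual_space_def)
  have sub: "subspace A"
    using A by (auto simp: subspace_def cfun.subspace_def simp flip: scaleC_of_real)
  have le: "Re (\<phi> f) \<le> K * norm f" if "f \<in> A" for f
    using bound[OF that] complex_Re_le_cmod[of "\<phi> f"] by linarith
  have Re_scale: "Re (\<phi> (r *\<^sub>R f)) = r * Re (\<phi> f)" if "f \<in> A" for r f
    using scale[OF that, of "of_real r"] by (simp add: scaleC_of_real)
  have Re_add: "Re (\<phi> (f + g)) = Re (\<phi> f) + Re (\<phi> g)" if "f \<in> A" "g \<in> A" for f g
    using add[OF that] by simp
  have "\<exists>U. (\<forall>f g. U (f + g) = U f + U g) \<and> (\<forall>r f. U (r *\<^sub>R f) = r * U f) \<and>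
      (\<forall>f. U f \<le> K * norm f) \<and> (\<forall>f\<in>A. U f = Re (\<phi> f))"
    by (rule Hahn_Banach_real[OF sub \<open>K \<ge> 0\<close>]) (simp_all add: Re_add Re_scale le)
  then obtain U where U': "(\<forall>f g. U (f + g) = U f + U g) \<and> (\<forall>r f. U (r *\<^sub>R f) = r * U f) \<and>
      (\<forall>f. U f \<le> K * norm f) \<and> (\<forall>f\<in>A. U f = Re (\<phi> f))" ..
  then have U: "\<And>f g. U (f + g) = U f + U g" "\<And>r f. U (r *\<^sub>R f) = r * U f"
    "\<And>f. U f \<le> K * norm f" "\<And>f. f \<in> A \<Longrightarrow> U f = Re (\<phi> f)" by simp_all
  define \<psi> where "\<psi> f = Complex (U f) (- U (scaleC_bcontfun \<i> f))" for f
  note \<psi> = complexified_functional[of U, OF U(1,2), folded \<psi>_def]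
  have le\<psi>: "cmod (\<psi> f) \<le> K * norm f" for f
    using \<psi>(3)[of f] U(3) by (metis mult_1 norm_scaleC_bcontfun)
  have eq: "\<psi> f = \<phi> f" if "f \<in> A" for f
    using that cfun.subspace_scale[OF A that, of \<i>]
    by (simp add: \<psi>_def U(4) scale complex_eq_iff)
  show thesis
    by (rule that[OF dual_spaceI[OF \<psi>(1,2) le\<psi>] le\<psi> eq])
qed

section \<open>The dual norm as the least bound of a functional\<close>

lemma dual_norm_upper:
  assumes "\<phi> \<in> dual_space A" "f \<in> A" "norm f \<le> 1"
  shows "cmod (\<phi> f) \<le> dual_norm A \<phi>"
proof -
  obtain K where K: "\<And>f. f \<in> A \<Longrightarrow> cmod (\<phi> f) \<le> K * norm f"
    using assms(1) unfolding dual_space_def by blast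
  have "bdd_above ((\<lambda>f. cmod (\<phi> f)) ` {f \<in> A. norm f \<le> 1})"
  proof (rule bdd_aboveI2)
    fix g assume "g \<in> {f \<in> A. norm f \<le> 1}"
    then have g: "cmod (\<phi> g) \<le> K * norm g" "norm g \<le> 1" using K by auto
    have "K * norm g \<le> \<bar>K\<bar> * 1" using g(2) by (intro mult_mono) auto
    with g(1) show "cmod (\<phi> g) \<le> \<bar>K\<bar>" by simp
  qed
  with assms(2,3) show ?thesis
    unfolding dual_norm_def by (intro cSUP_upper) auto
qed

lemma dual_norm_nonneg:
  assumes "cfun.subspace A" "\<phi> \<in> dual_space A"
  shows "0 \<le> dual_norm A \<phi>"
proof -
  have "cmod (\<phi> 0) \<le> dual_norm A \<phi>"
    by (rule dual_norm_upper[OF assms(2) cfun.subspace_0[OF assms(1)]]) simp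
  then show ?thesis using norm_ge_zero order_trans by blast
qed

lemma dual_norm_bound:
  assumes A: "cfun.subspace A" and \<phi>: "\<phi> \<in> dual_space A" and f: "f \<in> A"
  shows "cmod (\<phi> f) \<le> dual_norm A \<phi> * norm f"
proof (cases "norm f = 0")
  case True
  obtain K where "\<And>f. f \<in> A \<Longrightarrow> cmod (\<phi> f) \<le> K * norm f"
    using \<phi> unfolding dual_space_def by blast
  from this[OF f] True show ?thesis by simp
next
  case False
  define g where "g = scaleC_bcontfun (of_real (inverse (norm f))) f"
  have "g \<in> A" "norm g \<le> 1"
    using False cfun.subspace_scale[OF A f] by (simp_all add: g_def norm_inverse)
  then have "cmod (\<phi> g) \<le> dual_norm A \<phi>" by (rule dual_norm_upper[OF \<phi>])
  moreover have "\<phi> g = of_real (inverse (norm f)) * \<phi> f"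
    using \<phi> f by (auto simp: dual_space_def g_def)
  ultimately show ?thesis using False by (simp add: norm_mult norm_divide norm_inverse field_simps)
qed

lemma dual_norm_least:
  assumes A: "cfun.subspace A" and K: "K \<ge> 0" "\<And>f. f \<in> A \<Longrightarrow> cmod (\<phi> f) \<le> K * norm f"
  shows "dual_norm A \<phi> \<le> K"
  unfolding dual_norm_def
proof (rule cSUP_least)
  show "{f \<in> A. norm f \<le> 1} \<noteq> {}" using cfun.subspace_0[OF A] by auto
  fix f assume "f \<in> {f \<in> A. norm f \<le> 1}"
  then show "cmod (\<phi> f) \<le> K"
    using K(2)[of f] mult_left_le[of "norm f" K] K(1) by auto
qed

section \<open>Tensor products of functionals\<close>

lemma bounded_linear_scaleC: "bounded_linear (scaleC_bcontfun c)"
  by (rule bounded_linear_intro[where K = "cmod c"])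
    (auto intro!: bcontfun_eqI simp: algebra_simps scaleR_conv_of_real)

lemma subspace_tensor_hat: "cfun.subspace (tensor_hat A)"
proof -
  define S where "S = cfun.span {tensor_fun u v | u v. u \<in> A \<and> v \<in> A}"
  have S: "cfun.subspace S" unfolding S_def by (rule cfun.subspace_span)
  have "cfun.subspace (closure S)"
    unfolding cfun.subspace_def
  proof (intro conjI ballI allI)
    show "0 \<in> closure S" using cfun.subspace_0[OF S] closure_subset by blast
    show "f + g \<in> closure S" if "f \<in> closure S" "g \<in> closure S" for f g
    proof -
      obtain F G where "\<And>n. F n \<in> S" "F \<longlonglongrightarrow> f" "\<And>n. G n \<in> S" "G \<longlonglongrightarrow> g"
        using \<open>f \<in> _\<close> \<open>g \<in> _\<close> unfolding closure_sequential by blast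
      then show ?thesis unfolding closure_sequential
        by (intro exI[of _ "\<lambda>n. F n + G n"]) (auto intro: cfun.subspace_add[OF S] tendsto_add)
    qed
    show "scaleC_bcontfun c f \<in> closure S" if f: "f \<in> closure S" for c f
    proof -
      obtain F where "\<And>n. F n \<in> S" "F \<longlonglongrightarrow> f"
        using f unfolding closure_sequential by blast
      then show ?thesis unfolding closure_sequential
        by (intro exI[of _ "\<lambda>n. scaleC_bcontfun c (F n)"])
          (auto intro: cfun.subspace_scale[OF S] bounded_linear.tendsto[OF bounded_linear_scaleC])
    qed
  qed
  then show ?thesis by (simp add: tensor_hat_def S_def)
qed

lemma dual_space_restrict:
  assumes "\<mu> \<in> dual_space UNIV" "cfun.subspace A"
  shows "restrict \<mu> A \<in> dual_space A"
proof -
  obtain K where "\<And>f. cmod (\<mu> f) \<le> K * norm f" using dual_bound[OF assms(1)] by blast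
  then show ?thesis
    using assms(2) unfolding dual_space_def
    by (auto simp: dual_add[OF assms(1)] dual_scale[OF assms(1)] cfun.subspace_add cfun.subspace_scale)
qed

lemma tensor_fun_in_tensor_hat: "u \<in> A \<Longrightarrow> v \<in> A \<Longrightarrow> tensor_fun u v \<in> tensor_hat A"
  unfolding tensor_hat_def by (intro subsetD[OF closure_subset] cfun.span_base) blast

text \<open>Linearity gives agreement on the span of elementary tensors, boundedness on its closure.
  This is the uniqueness that the definite description in \<open>tensor_functional\<close>
  requires.\<close>

lemma dual_space_tensor_hat_eqI:
  assumes \<phi>: "\<phi> \<in> dual_space (tensor_hat A)" and \<psi>: "\<psi> \<in> dual_space (tensor_hat A)"
    and eq: "\<And>u v. u \<in> A \<Longrightarrow> v \<in> A \<Longrightarrow> \<phi> (tensor_fun u v) = \<psi> (tensor_fun u v)"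
  shows "\<phi> = \<psi>"
proof (rule extensionalityI[of _ "tensor_hat A"])
  show "\<phi> \<in> extensional (tensor_hat A)" "\<psi> \<in> extensional (tensor_hat A)"
    using \<phi> \<psi> by (auto simp: dual_space_def)
  fix F assume F: "F \<in> tensor_hat A"
  define B where "B = {tensor_fun u v | u v. u \<in> A \<and> v \<in> A}"
  have th: "tensor_hat A = closure (cfun.span B)" by (simp add: tensor_hat_def B_def)
  note sub = subspace_tensor_hat[of A]
  have lin: "\<And>G H. G \<in> tensor_hat A \<Longrightarrow> H \<in> tensor_hat A \<Longrightarrow> \<phi> (G + H) = \<phi> G + \<phi> H \<and> \<psi> (G + H) = \<psi> G + \<psi> H"
    "\<And>c G. G \<in> tensor_hat A \<Longrightarrow> \<phi> (scaleC_bcontfun c G) = c * \<phi> G \<and> \<psi> (scaleC_bcontfun c G) = c * \<psi> G"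
    using \<phi> \<psi> by (auto simp: dual_space_def)
  have "cfun.subspace {G \<in> tensor_hat A. \<phi> G = \<psi> G}"
    using sub lin(2)[of 0 0] cfun.subspace_0[OF sub]
    by (auto simp: cfun.subspace_def lin)
  moreover have "B \<subseteq> {G \<in> tensor_hat A. \<phi> G = \<psi> G}"
    using eq by (auto simp: B_def tensor_fun_in_tensor_hat)
  ultimately have span: "\<And>G. G \<in> cfun.span B \<Longrightarrow> G \<in> tensor_hat A \<and> \<phi> G = \<psi> G"
    using cfun.span_minimal[of B] by blast
  obtain K K' where K: "\<And>G. G \<in> tensor_hat A \<Longrightarrow> cmod (\<phi> G) \<le> K * norm G"
    "\<And>G. G \<in> tensor_hat A \<Longrightarrow> cmod (\<psi> G) \<le> K' * norm G"
    using \<phi> \<psi> unfolding dual_space_def by blast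
  obtain G where G: "\<And>n. G n \<in> cfun.span B" "G \<longlonglongrightarrow> F"
    using F unfolding th closure_sequential by blast
  have dist0: "(\<lambda>n. norm (F - G n)) \<longlonglongrightarrow> 0"
    using G(2) by (simp add: tendsto_iff dist_norm norm_minus_commute)
  have "cmod (\<phi> F - \<psi> F) \<le> (K + K') * norm (F - G n)" for n
  proof -
    have Gn: "G n \<in> tensor_hat A" and e: "\<phi> (G n) = \<psi> (G n)" using span[OF G(1)] by auto
    have D: "F - G n \<in> tensor_hat A" by (rule cfun.subspace_diff[OF sub F Gn])
    have "\<phi> F - \<psi> F = \<phi> (F - G n) - \<psi> (F - G n)"
      using lin(1)[OF D Gn] e by simp
    also have "cmod \<dots> \<le> K * norm (F - G n) + K' * norm (F - G n)"
      using norm_triangle_ineq4 K[OF D] by (smt (verit))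
    finally show ?thesis by (simp add: algebra_simps)
  qed
  moreover have "(\<lambda>n. (K + K') * norm (F - G n)) \<longlonglongrightarrow> 0"
    using tendsto_mult_left[OF dist0, of "K + K'"] by simp
  ultimately have "cmod (\<phi> F - \<psi> F) \<le> 0"
    using LIMSEQ_le_const by blast
  then show "\<phi> F = \<psi> F" by simp
qed

section \<open>The convolution algebra\<close>

lemma measure_algebra_simps [simp]:
  "carrier measure_algebra = dual_space UNIV"
  "mult measure_algebra = convolution"
  "one measure_algebra = (\<lambda>f. apply_bcontfun f 0)"
  "zero measure_algebra = (\<lambda>f. 0)"
  "add measure_algebra = (\<lambda>\<mu> \<nu> f. \<mu> f + \<nu> f)"
  "smult measure_algebra = (\<lambda>c \<mu> f. c * \<mu> f)"
  by (simp_all add: measure_algebra_def)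

lemma dual_algebra_simps [simp]:
  "carrier (dual_algebra A) = dual_space A"
  "mult (dual_algebra A) = (\<lambda>\<mu> \<nu>. \<lambda>f\<in>A. tensor_functional A \<mu> \<nu> (comult f))"
  "one (dual_algebra A) = (\<lambda>f\<in>A. apply_bcontfun f 0)"
  "zero (dual_algebra A) = (\<lambda>f\<in>A. 0)"
  "add (dual_algebra A) = (\<lambda>\<mu> \<nu>. \<lambda>f\<in>A. \<mu> f + \<nu> f)"
  "smult (dual_algebra A) = (\<lambda>c \<mu>. \<lambda>f\<in>A. c * \<mu> f)"
  by (simp_all add: dual_algebra_def)

lemma dual_space_plus:
  assumes "\<mu> \<in> dual_space UNIV" "\<nu> \<in> dual_space UNIV"
  shows "(\<lambda>f. \<mu> f + \<nu> f) \<in> dual_space UNIV"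
proof -
  obtain K K' where K: "\<And>f. cmod (\<mu> f) \<le> K * norm f" "\<And>f. cmod (\<nu> f) \<le> K' * norm f"
    using dual_bound[OF assms(1)] dual_bound[OF assms(2)] by metis
  have "cmod (\<mu> f + \<nu> f) \<le> (K + K') * norm f" for f
    using norm_triangle_ineq[of "\<mu> f" "\<nu> f"] K[of f] by (simp add: algebra_simps)
  then show ?thesis
    by (rule dual_spaceI[rotated 2])
      (auto simp: dual_add[OF assms(1)] dual_add[OF assms(2)] dual_scale[OF assms(1)]
        dual_scale[OF assms(2)] algebra_simps)
qed

lemma dual_space_cmult:
  assumes "\<mu> \<in> dual_space UNIV"
  shows "(\<lambda>f. c * \<mu> f) \<in> dual_space UNIV"
proof -
  obtain K where K: "\<And>f. cmod (\<mu> f) \<le> K * norm f" using dual_bound[OF assms(1)] by metis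
  have "cmod (c * \<mu> f) \<le> (cmod c * K) * norm f" for f
    using mult_left_mono[OF K[of f], of "cmod c"] by (simp add: norm_mult mult.assoc)
  then show ?thesis
    by (rule dual_spaceI[rotated 2])
      (auto simp: dual_add[OF assms(1)] dual_scale[OF assms(1)] algebra_simps)
qed

lemma dual_space_zero: "(\<lambda>f. 0) \<in> dual_space UNIV"
  by (rule dual_spaceI[where K = 0]) auto

lemma dual_space_eval: "(\<lambda>f. apply_bcontfun f x) \<in> dual_space UNIV"
  by (rule dual_spaceI[where K = 1]) (auto simp: norm_bounded)

text \<open>The iterated integral is the product of \<open>\<mu>\<close> and \<open>\<nu>\<close> on
  all continuous functions of two variables. Composed with \<open>comult\<close> it is the
  convolution; restricted to \<open>tensor_hat A\<close> it supplies the existence half of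
  \<open>tensor_functional\<close>.\<close>

lemma dual_space_partial_integral:
  fixes \<mu> :: "('x::topological_space \<Rightarrow>\<^sub>C complex) \<Rightarrow> complex"
  assumes X: "compact (UNIV :: 'x set)" and \<mu>: "\<mu> \<in> dual_space UNIV"
    and \<nu>: "\<nu> \<in> dual_space (UNIV :: ('y::topological_space \<Rightarrow>\<^sub>C complex) set)"
  shows "(\<lambda>F. \<nu> (partial_integral \<mu> F)) \<in> dual_space UNIV"
proof -
  note ap = partial_integral_apply[OF X \<mu>]
  obtain K where K: "K > 0" "\<And>f. cmod (\<mu> f) \<le> K * norm f" using dual_bound[OF \<mu>] by metis
  obtain K' where K': "K' > 0" "\<And>f. cmod (\<nu> f) \<le> K' * norm f" using dual_bound[OF \<nu>] by metis
  have sl: "slice_snd (F + G) y = slice_snd F y + slice_snd G y"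
    "slice_snd (scaleC_bcontfun c F) y = scaleC_bcontfun c (slice_snd F y)"
    for F G :: "('x \<times> 'y) \<Rightarrow>\<^sub>C complex" and c y
    by (auto intro!: bcontfun_eqI)
  have add: "partial_integral \<mu> (F + G) = partial_integral \<mu> F + partial_integral \<mu> G"
    for F G :: "('x \<times> 'y) \<Rightarrow>\<^sub>C complex"
    by (rule bcontfun_eqI) (simp add: ap sl dual_add[OF \<mu>])
  have scale: "partial_integral \<mu> (scaleC_bcontfun c F) = scaleC_bcontfun c (partial_integral \<mu> F)"
    for F :: "('x \<times> 'y) \<Rightarrow>\<^sub>C complex" and c
    by (rule bcontfun_eqI) (simp add: ap sl dual_scale[OF \<mu>])
  have "cmod (\<nu> (partial_integral \<mu> F)) \<le> (K' * K) * norm F" for F :: "('x \<times> 'y) \<Rightarrow>\<^sub>C complex"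
  proof -
    have "norm (slice_snd F y) \<le> norm F" for y by (rule norm_bound) (simp add: norm_bounded)
    then have "norm (partial_integral \<mu> F) \<le> K * norm F"
      using K by (intro norm_bound) (simp add: ap order_trans[OF K(2) mult_left_mono])
    then have "K' * norm (partial_integral \<mu> F) \<le> K' * (K * norm F)"
      using K'(1) by (intro mult_left_mono) auto
    with K'(2)[of "partial_integral \<mu> F"] show ?thesis by (simp add: mult.assoc)
  qed
  then show ?thesis
    by (rule dual_spaceI[rotated 2]) (simp_all add: add scale dual_add[OF \<nu>] dual_scale[OF \<nu>])
qed

context
  assumes compact_group: "compact (UNIV :: 'g::topological_group_add set)"
begin

lemma partial_integral_comult:
  fixes f :: "'g \<Rightarrow>\<^sub>C complex"
  assumes "\<mu> \<in> dual_space UNIV"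
  shows "partial_integral \<mu> (comult f) h = \<mu> (right_translate h f)"
  by (simp add: partial_integral_apply[OF compact_group assms])

lemma convolution_closed:
  fixes \<mu> \<nu> :: "('g \<Rightarrow>\<^sub>C complex) \<Rightarrow> complex"
  assumes "\<mu> \<in> dual_space UNIV" "\<nu> \<in> dual_space UNIV"
  shows "convolution \<mu> \<nu> \<in> dual_space UNIV"
proof -
  note D = dual_space_partial_integral[OF compact_group assms]
  obtain K where K: "K > 0" "\<And>F. cmod (\<nu> (partial_integral \<mu> F)) \<le> K * norm F"
    using dual_bound[OF D] by metis
  have co: "comult (f + g) = comult f + comult g"
    "comult (scaleC_bcontfun c f) = scaleC_bcontfun c (comult f)" for f g :: "'g \<Rightarrow>\<^sub>C complex" and c
    by (auto intro!: bcontfun_eqI)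
  have "cmod (\<nu> (partial_integral \<mu> (comult f))) \<le> K * norm f" for f
  proof -
    have "norm (comult f) \<le> norm f" by (rule norm_bound) (simp add: norm_bounded)
    then have "K * norm (comult f) \<le> K * norm f" using K(1) by simp
    with K(2)[of "comult f"] show ?thesis by linarith
  qed
  then show ?thesis
    unfolding convolution_partial_integral[abs_def]
    by (rule dual_spaceI[rotated 2]) (simp_all add: co dual_add[OF D] dual_scale[OF D])
qed

text \<open>Both sides integrate \<open>f\<close> over a triple product in the order
  \<open>\<mu>\<close>, \<open>\<nu>\<close>, \<open>\<rho>\<close>, so no interchange of integrals
  occurs. The point is that partial integration against \<open>\<mu>\<close> commutes with right
  translation.\<close>

lemma convolution_assoc:
  fixes \<mu> \<nu> \<rho> :: "('g \<Rightarrow>\<^sub>C complex) \<Rightarrow> complex"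
  assumes \<mu>: "\<mu> \<in> dual_space UNIV" and \<nu>: "\<nu> \<in> dual_space UNIV" and \<rho>: "\<rho> \<in> dual_space UNIV"
  shows "convolution (convolution \<mu> \<nu>) \<rho> = convolution \<mu> (convolution \<nu> \<rho>)"
proof
  fix f
  have "partial_integral \<mu> (comult (right_translate k f))
      = right_translate k (partial_integral \<mu> (comult f))" for k
  proof (rule bcontfun_eqI)
    fix h
    have "right_translate h (right_translate k f) = right_translate (h + k) f"
      by (rule bcontfun_eqI) (simp add: add.assoc)
    then show "partial_integral \<mu> (comult (right_translate k f)) h
        = right_translate k (partial_integral \<mu> (comult f)) h"
      by (simp add: partial_integral_comult[OF \<mu>])
  qed
  then have "partial_integral (convolution \<mu> \<nu>) (comult f)
      = partial_integral \<nu> (comult (partial_integral \<mu> (comult f)))"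
    by (intro bcontfun_eqI)
      (simp add: partial_integral_comult[OF convolution_closed[OF \<mu> \<nu>]] partial_integral_comult[OF \<nu>]
        convolution_partial_integral)
  then show "convolution (convolution \<mu> \<nu>) \<rho> f = convolution \<mu> (convolution \<nu> \<rho>) f"
    by (simp add: convolution_partial_integral)
qed

lemma ring_measure_algebra:
  "ring (measure_algebra :: (complex, ('g \<Rightarrow>\<^sub>C complex) \<Rightarrow> complex) module)"
proof (rule ringI)
  show "abelian_group (measure_algebra :: (complex, ('g \<Rightarrow>\<^sub>C complex) \<Rightarrow> complex) module)"
  proof (rule abelian_groupI)
    fix \<mu> :: "('g \<Rightarrow>\<^sub>C complex) \<Rightarrow> complex" assume "\<mu> \<in> carrier measure_algebra"
    then show "\<exists>\<nu>\<in>carrier measure_algebra. \<nu> \<oplus>\<^bsub>measure_algebra\<^esub> \<mu> = \<zero>\<^bsub>measure_algebra\<^esub>"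
      using dual_space_cmult[of \<mu> "-1"] by (intro bexI[of _ "\<lambda>f. - \<mu> f"]) auto
  qed (auto simp: dual_space_plus dual_space_zero add.assoc add.commute)
  have "partial_integral (\<lambda>f. apply_bcontfun f 0) (comult f) = f" for f :: "'g \<Rightarrow>\<^sub>C complex"
    by (rule bcontfun_eqI) (simp add: partial_integral_comult[OF dual_space_eval])
  moreover have "right_translate 0 f = f" for f :: "'g \<Rightarrow>\<^sub>C complex"
    by (rule bcontfun_eqI) simp
  ultimately show "monoid (measure_algebra :: (complex, ('g \<Rightarrow>\<^sub>C complex) \<Rightarrow> complex) module)"
    by (intro monoidI)
      (auto simp: convolution_closed dual_space_eval convolution_assoc convolution_partial_integral
        partial_integral_comult)
next
  fix \<mu> \<nu> \<rho> :: "('g \<Rightarrow>\<^sub>C complex) \<Rightarrow> complex"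
  assume "\<mu> \<in> carrier measure_algebra" "\<nu> \<in> carrier measure_algebra" "\<rho> \<in> carrier measure_algebra"
  then have D: "\<mu> \<in> dual_space UNIV" "\<nu> \<in> dual_space UNIV" "\<rho> \<in> dual_space UNIV" by simp_all
  have "partial_integral (\<lambda>f. \<mu> f + \<nu> f) (comult f)
      = partial_integral \<mu> (comult f) + partial_integral \<nu> (comult f)" for f :: "'g \<Rightarrow>\<^sub>C complex"
    by (rule bcontfun_eqI)
      (simp add: partial_integral_comult[OF dual_space_plus[OF D(1,2)]] partial_integral_comult[OF D(1)]
        partial_integral_comult[OF D(2)])
  then show "(\<mu> \<oplus>\<^bsub>measure_algebra\<^esub> \<nu>) \<otimes>\<^bsub>measure_algebra\<^esub> \<rho>
      = \<mu> \<otimes>\<^bsub>measure_algebra\<^esub> \<rho> \<oplus>\<^bsub>measure_algebra\<^esub> \<nu> \<otimes>\<^bsub>measure_algebra\<^esub> \<rho>"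
    by (auto simp: convolution_partial_integral dual_add[OF D(3)])
  show "\<rho> \<otimes>\<^bsub>measure_algebra\<^esub> (\<mu> \<oplus>\<^bsub>measure_algebra\<^esub> \<nu>)
      = \<rho> \<otimes>\<^bsub>measure_algebra\<^esub> \<mu> \<oplus>\<^bsub>measure_algebra\<^esub> \<rho> \<otimes>\<^bsub>measure_algebra\<^esub> \<nu>"
    by (auto simp: convolution_partial_integral)
qed

text \<open>Evaluates the definite description for functionals that extend to the whole space; by
  Hahn-Banach these are all functionals on \<open>A\<close>.\<close>

lemma tensor_functional_restrict:
  fixes A :: "('g \<Rightarrow>\<^sub>C complex) set"
  assumes \<mu>: "\<mu> \<in> dual_space UNIV" and \<nu>: "\<nu> \<in> dual_space UNIV"
  shows "tensor_functional A (restrict \<mu> A) (restrict \<nu> A)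
    = restrict (\<lambda>F. \<nu> (partial_integral \<mu> F)) (tensor_hat A)"
  unfolding tensor_functional_def
proof (rule the_equality, intro conjI ballI)
  note D = dual_space_partial_integral[OF compact_group \<mu> \<nu>]
  show *: "restrict (\<lambda>F. \<nu> (partial_integral \<mu> F)) (tensor_hat A) \<in> dual_space (tensor_hat A)"
    by (rule dual_space_restrict[OF D subspace_tensor_hat])
  show **: "restrict (\<lambda>F. \<nu> (partial_integral \<mu> F)) (tensor_hat A) (tensor_fun u v)
      = restrict \<mu> A u * restrict \<nu> A v" if "u \<in> A" "v \<in> A" for u v
  proof -
    have "slice_snd (tensor_fun u v) h = scaleC_bcontfun (v h) u" for h
      by (rule bcontfun_eqI) (simp add: mult.commute)
    then have "partial_integral \<mu> (tensor_fun u v) = scaleC_bcontfun (\<mu> u) v"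
      by (intro bcontfun_eqI)
        (simp add: partial_integral_apply[OF compact_group \<mu>] dual_scale[OF \<mu>] mult.commute)
    then show ?thesis
      using that by (simp add: tensor_fun_in_tensor_hat dual_scale[OF \<nu>])
  qed
  fix \<phi>
  assume "\<phi> \<in> dual_space (tensor_hat A) \<and>
    (\<forall>u\<in>A. \<forall>v\<in>A. \<phi> (tensor_fun u v) = restrict \<mu> A u * restrict \<nu> A v)"
  then show "\<phi> = restrict (\<lambda>F. \<nu> (partial_integral \<mu> F)) (tensor_hat A)"
    using ** by (intro dual_space_tensor_hat_eqI[OF _ *]) auto
qed

section \<open>The annihilator as kernel of restriction, and the quotient isomorphism\<close>

lemma dual_algebra_quotient:
  fixes A :: "('g \<Rightarrow>\<^sub>C complex) set"
  assumes A: "cfun.subspace A" and comult: "comult ` A \<subseteq> tensor_hat A"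
  shows "ideal (annihilator A) measure_algebra" (is ?ideal)
    and "\<exists>\<Phi>. \<Phi> \<in> banach_algebra_iso
        (quotient_algebra measure_algebra (annihilator A)) (quotient_norm (dual_norm UNIV))
        (dual_algebra A) (dual_norm A)" (is ?iso)
proof -
  let ?M = "measure_algebra :: (complex, ('g \<Rightarrow>\<^sub>C complex) \<Rightarrow> complex) module"
  define \<Lambda> where "\<Lambda> \<mu> = restrict \<mu> A" for \<mu> :: "('g \<Rightarrow>\<^sub>C complex) \<Rightarrow> complex"
  have extend: "\<exists>\<psi>\<in>dual_space UNIV. \<Lambda> \<psi> = \<phi> \<and> dual_norm UNIV \<psi> \<le> dual_norm A \<phi>" if \<phi>: "\<phi> \<in> dual_space A" for \<phi>
  proof -
    obtain \<psi> where \<psi>: "\<psi> \<in> dual_space UNIV" "\<And>f. cmod (\<psi> f) \<le> dual_norm A \<phi> * norm f"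
      "\<And>f. f \<in> A \<Longrightarrow> \<psi> f = \<phi> f"
      using Hahn_Banach_bcontfun[OF A \<phi> dual_norm_nonneg[OF A \<phi>] dual_norm_bound[OF A \<phi>]] by metis
    have "\<Lambda> \<psi> = \<phi>"
      using \<phi> \<psi>(3) by (auto simp: \<Lambda>_def dual_space_def intro: extensionalityI[of _ A])
    moreover have "dual_norm UNIV \<psi> \<le> dual_norm A \<phi>"
      using \<psi>(2) dual_norm_nonneg[OF A \<phi>] by (intro dual_norm_least) (auto simp: cfun.subspace_UNIV)
    ultimately show ?thesis using \<psi>(1) by blast
  qed
  have \<Lambda>_closed: "\<Lambda> \<mu> \<in> dual_space A" if "\<mu> \<in> dual_space UNIV" for \<mu>
    unfolding \<Lambda>_def by (rule dual_space_restrict[OF that A])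
  have \<Lambda>_hom: "\<Lambda> \<in> ring_hom ?M (dual_algebra A)"
  proof (rule ring_hom_memI)
    fix \<mu> \<nu> assume "\<mu> \<in> carrier ?M" "\<nu> \<in> carrier ?M"
    then have D: "\<mu> \<in> dual_space UNIV" "\<nu> \<in> dual_space UNIV" by simp_all
    show "\<Lambda> (\<mu> \<otimes>\<^bsub>?M\<^esub> \<nu>) = \<Lambda> \<mu> \<otimes>\<^bsub>dual_algebra A\<^esub> \<Lambda> \<nu>"
    proof
      fix f
      \<comment> \<open>The functional on the right has its proper value only on
        \<open>tensor_hat A\<close>, so this membership is what makes restriction multiplicative.
        Off \<open>A\<close> both sides are \<open>undefined\<close>.\<close>
      have "f \<in> A \<Longrightarrow> comult f \<in> tensor_hat A" using comult by blast
      then show "\<Lambda> (\<mu> \<otimes>\<^bsub>?M\<^esub> \<nu>) f = (\<Lambda> \<mu> \<otimes>\<^bsub>dual_algebra A\<^esub> \<Lambda> \<nu>) f"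
        by (cases "f \<in> A")
          (simp_all add: \<Lambda>_def tensor_functional_restrict[OF D] convolution_partial_integral)
    qed
  qed (auto simp: \<Lambda>_closed, auto simp: \<Lambda>_def)
  have image: "\<Lambda> ` carrier ?M = carrier (dual_algebra A)"
    using extend \<Lambda>_closed by auto
  interpret M: ring ?M by (rule ring_measure_algebra)
  \<comment> \<open>The ring axioms of \<open>dual_algebra A\<close> are not checked directly:
    restriction is onto, so they are inherited as those of a homomorphic image of the measure
    algebra.\<close>
  have "dual_algebra A \<lparr>carrier := \<Lambda> ` carrier ?M, zero := \<Lambda> \<zero>\<^bsub>?M\<^esub>\<rparr> = dual_algebra A"
    unfolding image by (simp add: dual_algebra_def \<Lambda>_def)
  then have "ring (dual_algebra A)"
    using M.ring_hom_imp_img_ring[OF \<Lambda>_hom] by simp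
  then interpret \<Lambda>: ring_hom_ring ?M "dual_algebra A" \<Lambda>
    using ring_hom_ringI2[OF M.ring_axioms _ \<Lambda>_hom] by blast
  have \<Lambda>0: "\<Lambda> \<mu> = (\<lambda>f\<in>A. 0) \<longleftrightarrow> (\<forall>f\<in>A. \<mu> f = 0)" for \<mu>
  proof
    assume eq: "\<Lambda> \<mu> = (\<lambda>f\<in>A. 0)"
    show "\<forall>f\<in>A. \<mu> f = 0"
    proof
      fix f assume "f \<in> A"
      with fun_cong[OF eq, of f] show "\<mu> f = 0" by (simp add: \<Lambda>_def)
    qed
  next
    assume "\<forall>f\<in>A. \<mu> f = 0"
    then show "\<Lambda> \<mu> = (\<lambda>f\<in>A. 0)" unfolding \<Lambda>_def by (intro restrict_ext) simp
  qed
  have ker: "a_kernel ?M (dual_algebra A) \<Lambda> = annihilator A"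
    by (simp only: a_kernel_def' annihilator_def measure_algebra_simps dual_algebra_simps \<Lambda>0)
  show ?ideal using \<Lambda>.kernel_is_ideal by (simp add: ker)
  define I where "I = annihilator A"
  \<comment> \<open>Restriction is constant on each coset, so the image of a coset is a
    singleton.\<close>
  define \<Phi> where "\<Phi> X = the_elem (\<Lambda> ` X)" for X
  have coset: "I +>\<^bsub>?M\<^esub> \<mu> = {\<nu> \<in> dual_space UNIV. \<Lambda> \<nu> = \<Lambda> \<mu>}" if \<mu>: "\<mu> \<in> dual_space UNIV" for \<mu>
  proof (intro Set.set_eqI iffI)
    fix \<nu> assume "\<nu> \<in> I +>\<^bsub>?M\<^esub> \<mu>"
    then obtain \<iota> where "\<iota> \<in> I" "\<nu> = (\<lambda>f. \<iota> f + \<mu> f)" by (auto simp: a_r_coset_def')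
    then show "\<nu> \<in> {\<nu> \<in> dual_space UNIV. \<Lambda> \<nu> = \<Lambda> \<mu>}"
      using \<mu> by (auto simp: I_def annihilator_def dual_space_plus \<Lambda>_def)
  next
    fix \<nu> assume \<nu>: "\<nu> \<in> {\<nu> \<in> dual_space UNIV. \<Lambda> \<nu> = \<Lambda> \<mu>}"
    define \<iota> where "\<iota> f = \<nu> f + - 1 * \<mu> f" for f
    have "\<iota> \<in> dual_space UNIV"
      unfolding \<iota>_def using \<nu> \<mu> by (intro dual_space_plus dual_space_cmult) auto
    moreover have "\<iota> f = 0" if "f \<in> A" for f
    proof -
      have "\<Lambda> \<nu> f = \<Lambda> \<mu> f" using \<nu> by simp
      with that show ?thesis by (simp add: \<iota>_def \<Lambda>_def)
    qed
    ultimately have "\<iota> \<in> I" by (auto simp: I_def annihilator_def)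
    moreover have "\<nu> = (\<lambda>f. \<iota> f + \<mu> f)" by (auto simp: \<iota>_def)
    ultimately show "\<nu> \<in> I +>\<^bsub>?M\<^esub> \<mu>" by (auto simp: a_r_coset_def')
  qed
  have \<Phi>_coset: "\<Phi> (I +>\<^bsub>?M\<^esub> \<mu>) = \<Lambda> \<mu>" if "\<mu> \<in> dual_space UNIV" for \<mu>
    using \<Lambda>.the_elem_simp[of \<mu>] that by (simp add: \<Phi>_def ker I_def)
  have Q: "carrier (quotient_algebra ?M I) = {I +>\<^bsub>?M\<^esub> \<mu> | \<mu>. \<mu> \<in> dual_space UNIV}"
    by (auto simp: quotient_algebra_def ring.defs FactRing_def A_RCOSETS_def')
  have "\<Phi> \<in> ring_iso (?M Quot I) (dual_algebra A)"
    using \<Lambda>.FactRing_iso_set[OF image] unfolding \<Phi>_def[abs_def] ker I_def .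
  then have iso: "\<Phi> \<in> ring_iso (quotient_algebra ?M I) (dual_algebra A)"
    by (simp add: ring_iso_def ring_hom_def quotient_algebra_def ring.defs)
  have smult: "\<Phi> (c \<odot>\<^bsub>quotient_algebra ?M I\<^esub> X) = c \<odot>\<^bsub>dual_algebra A\<^esub> \<Phi> X"
    if X: "X \<in> carrier (quotient_algebra ?M I)" for c X
  proof -
    obtain \<mu> where \<mu>: "\<mu> \<in> dual_space UNIV" "X = I +>\<^bsub>?M\<^esub> \<mu>" using X Q by auto
    have scale: "\<Lambda> (\<lambda>f. c * \<nu> f) = (\<lambda>f\<in>A. c * \<Lambda> \<nu> f)" for \<nu> by (auto simp: \<Lambda>_def)
    \<comment> \<open>The restriction of \<open>c * \<nu>\<close> depends only on that of
      \<open>\<nu>\<close>, so all members of the union defining the scalar multiple are one and the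
      same coset.\<close>
    have const: "I +>\<^bsub>?M\<^esub> (\<lambda>f. c * \<nu> f) = I +>\<^bsub>?M\<^esub> (\<lambda>f. c * \<mu> f)" if "\<nu> \<in> X" for \<nu>
      using that \<mu> by (simp add: coset dual_space_cmult scale)
    have "X \<noteq> {}" using \<mu> by (auto simp: coset)
    have "c \<odot>\<^bsub>quotient_algebra ?M I\<^esub> X = (\<Union>\<nu>\<in>X. I +>\<^bsub>?M\<^esub> (\<lambda>f. c * \<nu> f))"
      by (simp add: quotient_algebra_def ring.defs)
    also have "\<dots> = (\<Union>\<nu>\<in>X. I +>\<^bsub>?M\<^esub> (\<lambda>f. c * \<mu> f))"
      by (intro SUP_cong refl const)
    also have "\<dots> = I +>\<^bsub>?M\<^esub> (\<lambda>f. c * \<mu> f)" using \<open>X \<noteq> {}\<close> by (rule SUP_const)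
    finally have "c \<odot>\<^bsub>quotient_algebra ?M I\<^esub> X = I +>\<^bsub>?M\<^esub> (\<lambda>f. c * \<mu> f)" .
    then show ?thesis using \<mu> by (simp add: \<Phi>_coset dual_space_cmult scale)
  qed
  have norm_le: "dual_norm A (\<Phi> X) \<le> 1 * quotient_norm (dual_norm UNIV) X"
    and norm_ge: "quotient_norm (dual_norm UNIV) X \<le> 1 * dual_norm A (\<Phi> X)"
    if X: "X \<in> carrier (quotient_algebra ?M I)" for X
  proof -
    obtain \<mu> where \<mu>: "\<mu> \<in> dual_space UNIV" "X = I +>\<^bsub>?M\<^esub> \<mu>" using X Q by auto
    then have X_eq: "X = {\<nu> \<in> dual_space UNIV. \<Lambda> \<nu> = \<Lambda> \<mu>}" and \<Phi>X: "\<Phi> X = \<Lambda> \<mu>"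
      using coset[OF \<mu>(1)] \<Phi>_coset[OF \<mu>(1)] by simp_all
    have "dual_norm A (\<Lambda> \<mu>) \<le> (INF \<nu>\<in>X. dual_norm UNIV \<nu>)"
    proof (rule cINF_greatest)
      show "X \<noteq> {}" using \<mu>(1) by (auto simp: X_eq)
      fix \<nu> assume "\<nu> \<in> X"
      then have \<nu>: "\<nu> \<in> dual_space UNIV" "\<Lambda> \<nu> = \<Lambda> \<mu>" by (auto simp: X_eq)
      have "dual_norm A (\<Lambda> \<nu>) \<le> dual_norm UNIV \<nu>"
        using dual_norm_bound[OF cfun.subspace_UNIV \<nu>(1)] dual_norm_nonneg[OF cfun.subspace_UNIV \<nu>(1)]
        by (intro dual_norm_least A) (auto simp: \<Lambda>_def)
      then show "dual_norm A (\<Lambda> \<mu>) \<le> dual_norm UNIV \<nu>" by (simp add: \<nu>)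
    qed
    then show "dual_norm A (\<Phi> X) \<le> 1 * quotient_norm (dual_norm UNIV) X"
      by (simp add: \<Phi>X quotient_norm_def)
    \<comment> \<open>A norm-preserving extension of the restricted functional is itself a
      representative of the coset, which bounds the infimum. With the other estimate, both constants
      are 1.\<close>
    obtain \<psi> where \<psi>: "\<psi> \<in> dual_space UNIV" "\<Lambda> \<psi> = \<Lambda> \<mu>" "dual_norm UNIV \<psi> \<le> dual_norm A (\<Lambda> \<mu>)"
      using extend[OF \<Lambda>_closed[OF \<mu>(1)]] by blast
    have "(INF \<nu>\<in>X. dual_norm UNIV \<nu>) \<le> dual_norm UNIV \<psi>"
    proof (rule cINF_lower)
      show "bdd_below (dual_norm UNIV ` X)"
        by (rule bdd_belowI2[of _ 0]) (auto simp: X_eq intro: dual_norm_nonneg[OF cfun.subspace_UNIV])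
      show "\<psi> \<in> X" using \<psi> by (simp add: X_eq)
    qed
    with \<psi>(3) show "quotient_norm (dual_norm UNIV) X \<le> 1 * dual_norm A (\<Phi> X)"
      by (simp add: \<Phi>X quotient_norm_def)
  qed
  have "\<Phi> \<in> banach_algebra_iso (quotient_algebra ?M I) (quotient_norm (dual_norm UNIV))
      (dual_algebra A) (dual_norm A)"
    unfolding banach_algebra_iso_def using iso smult norm_le norm_ge by blast
  then show ?iso unfolding I_def by blast
qed

end

theorem proposition2:
  fixes A :: "('g::{topological_group_add, t2_space} \<Rightarrow>\<^sub>C complex) set"
  assumes "compact (UNIV :: 'g set)"
    and "cfun.subspace A" and "closed A"
  shows "(invariant_algebra A \<longleftrightarrow> sub_bialgebra A) \<and>
    (invariant_algebra A \<longrightarrow>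
      ideal (annihilator A) measure_algebra \<and>
      (\<exists>\<Phi>. \<Phi> \<in> banach_algebra_iso
        (quotient_algebra measure_algebra (annihilator A)) (quotient_norm (dual_norm UNIV))
        (dual_algebra A) (dual_norm A)))"
proof -
  have equiv: "invariant_algebra A \<longleftrightarrow> sub_bialgebra A"
    using invariant_algebra_imp_sub_bialgebra[OF assms(1)] sub_bialgebra_imp_invariant_algebra
    by blast
  then have "comult ` A \<subseteq> tensor_hat A" if "invariant_algebra A"
    using that by (simp add: sub_bialgebra_def)
  with equiv dual_algebra_quotient[OF assms(1,2)] show ?thesis by blast
qed

end
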